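(* Let $T_a:[0,1]\to[0,1]$, $a\in I$, be a one-parameter family as described in the context, satisfying properties (i)-(iii) there, and assume the Markov property: for each $1\le k\le p_0$ and $a\in I$, writing $B_k(a)=(b_{k-1}(a),b_k(a))$, the image $T_a(B_k(a))$ is, modulo a finite number of points, a union of intervals $B_l(a)$, $1\le l\le p_0$. If $X:I\to[0,1]$ is a $C^1$ map for which condition (I) of the context is fulfilled, then $X(a)$ is typical for $\mu_a$ for a.e. $a\in I$.
   Context: $C^{1,1}(L)$ means $C^1$ with derivative Lipschitz with constant at most $L$; $\mathrm{Lip}(L)$ means Lipschitz with constant at most $L$. Family. $I\subset\mathbb R$ is an interval of finite length, $0<L<\infty$, $1<\lambda\le\Lambda<\infty$, and for each $a\in I$, $T_a:[0,1]\to[0,1]$ is a map with a partition $0=b_0(a)<b_1(a)<\dots<b_{p(a)}(a)=1$ such that $T_a$ is $C^{1,1}(L)$ on each $(b_{k-1}(a),b_k(a))$ and $\lambda\le|\partial_xT_a(x)|\le\Lambda$ for all $x$ outside the partition points. For each $a\in I$, $T_a$ has a unique absolutely continuous invariant probability measure $\mu_a$; $K(a)=\mathrm{supp}(\mu_a)$ (a finite union of intervals). Properties: (i) $p(a)\equiv p_0$ is constant, each $b_k$ is $\mathrm{Lip}(L)$ on $I$, and there is $\delta_0>0$ with $b_k(a)-b_{k-1}(a)\ge\delta_0$ for all $1\le k\le p_0$, $a\in I$. (ii) If $x\in[0,1]$ and $J\subset I$ is an interval with $b_k(a)\ne x$ for all $a\in J$, $0\le k\le p_0$, then $a\mapsto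 T_a(x)$ is $C^1(J)$ and both $a\mapsto T_a(x)$ and $a\mapsto\partial_xT_a(x)$ are $\mathrm{Lip}(L)$ on $J$. (iii) Let $D_1(a),\dots,D_{p_1(a)}(a)$ be the connected components of $K(a)\setminus\{b_0(a),\dots,b_{p_0}(a)\}$. The number $p_1(a)\equiv p_1$ is constant and the boundary points of each $D_k(a)$ change continuously in $a\in I$. Condition (I). Let $x_j(a)=T_a^j(X(a))$, $j\ge0$. For $j\ge1$, $\mathcal P_j|I$ is the set of maximal open intervals $\omega\subset\mathrm{int}(I)$ such that $x_i(a)\in K(a)\setminus\{b_0(a),\dots,b_{p_0}(a)\}$ for all $a\in\omega$ and $0\le i<j$. Write $x_j'(a)=D_ax_j(a)$ and $(T_a^j)'=\partial_xT_a^j$. Condition (I) says: there is $C_0\ge1$ such that for all $j\ge1$, $\omega\in\mathcal P_j|I$ and $a\in\omega$, $C_0^{-1}\le|x_j'(a)/(T_a^j)'(X(a))|\le C_0$; moreover for each $j\ge1$ the number of $a\in I$ not contained in any $\omega\in\mathcal P_j|I$ is finite. Typical: $x$ is typical for $\mu_a$ if $\frac1n\sum_{i=0}^{n-1}\delta_{T_a^i(x)}\to\mu_a$ weak-$*$ as $n\to\infty$. *)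

theory Defs
  imports "HOL-Probability.Probability"
begin

text \<open>Derivatives are taken within the set, so that they are one-sided at the endpoints of an
  interval that contains them.\<close>

definition C1_on :: "real set \<Rightarrow> (real \<Rightarrow> real) \<Rightarrow> bool" where
  "C1_on S f \<longleftrightarrow>
     (\<exists>f'. (\<forall>x\<in>S. (f has_real_derivative f' x) (at x within S)) \<and> continuous_on S f')"

definition C11_on :: "real \<Rightarrow> real set \<Rightarrow> (real \<Rightarrow> real) \<Rightarrow> bool" where
  "C11_on L S f \<longleftrightarrow>
     (\<exists>f'. (\<forall>x\<in>S. (f has_real_derivative f' x) (at x within S)) \<and> L-lipschitz_on S f')"

text \<open>Measures on $[0,1]$ live on the Borel sigma-algebra of \<open>{0..1}\<close>, so a map \<open>f\<close> of the unit
  interval is never evaluated outside \<open>{0..1}\<close>.\<close>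

abbreviation unit_borel :: "real measure" where
  "unit_borel \<equiv> restrict_space borel {0..1}"

definition acip :: "(real \<Rightarrow> real) \<Rightarrow> real measure \<Rightarrow> bool" where
  "acip f \<mu> \<longleftrightarrow>
     sets \<mu> = sets unit_borel \<and> prob_space \<mu> \<and>
     absolutely_continuous (restrict_space lborel {0..1}) \<mu> \<and>
     f \<in> measurable \<mu> \<mu> \<and> distr \<mu> \<mu> f = \<mu>"

definition supp :: "real measure \<Rightarrow> real set" where
  "supp \<mu> = {x \<in> space \<mu>. \<forall>U. open U \<and> x \<in> U \<longrightarrow> emeasure \<mu> (U \<inter> space \<mu>) > 0}"

text \<open>The measure $\frac1n\sum_{i=0}^{n-1}\delta_{f^i(x)}$, as the image of the uniform
  distribution on $\{0,\dots,n-1\}$ under $i\mapsto f^i(x)$; see \<open>integral_empirical_measure\<close>.\<close>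

definition empirical_measure :: "(real \<Rightarrow> real) \<Rightarrow> real \<Rightarrow> nat \<Rightarrow> real measure" where
  "empirical_measure f x n =
     distr (uniform_count_measure {..<n}) unit_borel (\<lambda>i. (f ^^ i) x)"

definition weak_star_conv :: "(nat \<Rightarrow> real measure) \<Rightarrow> real measure \<Rightarrow> bool" where
  "weak_star_conv M \<mu> \<longleftrightarrow>
     (\<forall>\<phi> :: real \<Rightarrow> real. continuous_on {0..1} \<phi> \<longrightarrow>
        (\<lambda>n. \<integral>x. \<phi> x \<partial>M n) \<longlonglongrightarrow> (\<integral>x. \<phi> x \<partial>\<mu>))"

definition typical :: "(real \<Rightarrow> real) \<Rightarrow> real measure \<Rightarrow> real \<Rightarrow> bool" where
  "typical f \<mu> x \<longleftrightarrow> weak_star_conv (empirical_measure f x) \<mu>"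

lemma funpow_unit_interval:
  fixes f :: "real \<Rightarrow> real"
  assumes "f \<in> {0..1} \<rightarrow> {0..1}" "x \<in> {0..1}"
  shows "(f ^^ i) x \<in> {0..1}"
  using assms by (induction i) (auto simp: Pi_iff)

lemma integral_empirical_measure:
  fixes f \<phi> :: "real \<Rightarrow> real"
  assumes "f \<in> {0..1} \<rightarrow> {0..1}" "x \<in> {0..1}" "continuous_on {0..1} \<phi>"
  shows "(\<integral>y. \<phi> y \<partial>empirical_measure f x n) = (\<Sum>i<n. \<phi> ((f ^^ i) x)) / n"
proof -
  have "\<phi> \<in> borel_measurable unit_borel"
    using assms(3) by (rule borel_measurable_continuous_on_restrict)
  moreover have "(\<lambda>i. (f ^^ i) x) \<in> measurable (uniform_count_measure {..<n}) unit_borel"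
    using funpow_unit_interval[OF assms(1,2)]
    by (auto simp: measurable_def space_uniform_count_measure sets_uniform_count_measure
        space_restrict_space)
  ultimately show ?thesis
    unfolding empirical_measure_def by (simp add: integral_distr integral_uniform_count_measure)
qed

definition partition_points :: "(real \<Rightarrow> nat) \<Rightarrow> (real \<Rightarrow> nat \<Rightarrow> real) \<Rightarrow> real \<Rightarrow> real set" where
  "partition_points p b a = b a ` {..p a}"

definition branch_interval :: "(real \<Rightarrow> nat \<Rightarrow> real) \<Rightarrow> real \<Rightarrow> nat \<Rightarrow> real set" where
  "branch_interval b a k = {b a (k - 1)<..<b a k}"

text \<open>The parameters \<open>lam\<close> and \<open>Lam\<close> are the lower and upper bounds for $|\partial_x T_a|$. Since
  every point of \<open>{0..1}\<close> off the partition lies in an open branch interval,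
  $\partial_x T_a(x)$ is the ordinary derivative \<open>deriv (T a) x\<close>.\<close>

locale piecewise_expanding_family =
  fixes I :: "real set" and L lam Lam :: real
    and T :: "real \<Rightarrow> real \<Rightarrow> real"
    and p :: "real \<Rightarrow> nat" and b :: "real \<Rightarrow> nat \<Rightarrow> real"
    and \<mu> :: "real \<Rightarrow> real measure"
  assumes parameter_interval: "is_interval I" "bounded I"
    and constants: "0 < L" "1 < lam" "lam \<le> Lam"
    and self_map: "\<And>a. a \<in> I \<Longrightarrow> T a \<in> {0..1} \<rightarrow> {0..1}"
    and partition_ends: "\<And>a. a \<in> I \<Longrightarrow> b a 0 = 0" "\<And>a. a \<in> I \<Longrightarrow> b a (p a) = 1"
    and partition_mono: "\<And>a k. a \<in> I \<Longrightarrow> k \<in> {1..p a} \<Longrightarrow> b a (k - 1) < b a k"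
    and branches_C11:
      "\<And>a k. a \<in> I \<Longrightarrow> k \<in> {1..p a} \<Longrightarrow> C11_on L (branch_interval b a k) (T a)"
    and expanding:
      "\<And>a x. a \<in> I \<Longrightarrow> x \<in> {0..1} - partition_points p b a \<Longrightarrow>
         lam \<le> \<bar>deriv (T a) x\<bar> \<and> \<bar>deriv (T a) x\<bar> \<le> Lam"
    and unique_acip: "\<And>a \<nu>. a \<in> I \<Longrightarrow> acip (T a) \<nu> \<longleftrightarrow> \<nu> = \<mu> a"

definition property_i ::
    "real set \<Rightarrow> real \<Rightarrow> (real \<Rightarrow> nat) \<Rightarrow> (real \<Rightarrow> nat \<Rightarrow> real) \<Rightarrow> nat \<Rightarrow> bool" where
  "property_i I L p b p0 \<longleftrightarrow>
     (\<forall>a\<in>I. p a = p0) \<and>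
     (\<forall>k\<le>p0. L-lipschitz_on I (\<lambda>a. b a k)) \<and>
     (\<exists>\<delta>0>0. \<forall>k\<in>{1..p0}. \<forall>a\<in>I. b a k - b a (k - 1) \<ge> \<delta>0)"

definition property_ii ::
    "real set \<Rightarrow> real \<Rightarrow> (real \<Rightarrow> real \<Rightarrow> real) \<Rightarrow> (real \<Rightarrow> nat \<Rightarrow> real) \<Rightarrow> nat \<Rightarrow> bool" where
  "property_ii I L T b p0 \<longleftrightarrow>
     (\<forall>x\<in>{0..1}. \<forall>J\<subseteq>I. is_interval J \<and> (\<forall>a\<in>J. \<forall>k\<le>p0. b a k \<noteq> x) \<longrightarrow>
        C1_on J (\<lambda>a. T a x) \<and>
        L-lipschitz_on J (\<lambda>a. T a x) \<and>
        L-lipschitz_on J (\<lambda>a. deriv (T a) x))"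

text \<open>The components \<open>D k a\<close> are intervals, with boundary points \<open>Inf (D k a)\<close> and
  \<open>Sup (D k a)\<close>. That they are finite in number makes \<open>supp (\<mu> a)\<close> a finite union of
  intervals.\<close>

definition property_iii ::
    "real set \<Rightarrow> (real \<Rightarrow> nat) \<Rightarrow> (real \<Rightarrow> nat \<Rightarrow> real) \<Rightarrow> (real \<Rightarrow> real measure) \<Rightarrow> bool" where
  "property_iii I p b \<mu> \<longleftrightarrow>
     (\<exists>p1 (D :: nat \<Rightarrow> real \<Rightarrow> real set).
        (\<forall>a\<in>I. bij_betw (\<lambda>k. D k a) {1..p1}
                  (components (supp (\<mu> a) - partition_points p b a))) \<and>
        (\<forall>k\<in>{1..p1}. continuous_on I (\<lambda>a. Inf (D k a)) \<and> continuous_on I (\<lambda>a. Sup (D k a))))"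

definition markov_property ::
    "real set \<Rightarrow> (real \<Rightarrow> real \<Rightarrow> real) \<Rightarrow> (real \<Rightarrow> nat \<Rightarrow> real) \<Rightarrow> nat \<Rightarrow> bool" where
  "markov_property I T b p0 \<longleftrightarrow>
     (\<forall>k\<in>{1..p0}. \<forall>a\<in>I. \<exists>M\<subseteq>{1..p0}.
        finite (sym_diff (T a ` branch_interval b a k) (\<Union>l\<in>M. branch_interval b a l)))"

definition orbit_map ::
    "(real \<Rightarrow> real \<Rightarrow> real) \<Rightarrow> (real \<Rightarrow> real) \<Rightarrow> nat \<Rightarrow> real \<Rightarrow> real" where
  "orbit_map T X j a = (T a ^^ j) (X a)"

definition admissible_interval ::
    "real set \<Rightarrow> (real \<Rightarrow> real \<Rightarrow> real) \<Rightarrow> (real \<Rightarrow> nat) \<Rightarrow> (real \<Rightarrow> nat \<Rightarrow> real) \<Rightarrow>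
     (real \<Rightarrow> real measure) \<Rightarrow> (real \<Rightarrow> real) \<Rightarrow> nat \<Rightarrow> real set \<Rightarrow> bool" where
  "admissible_interval I T p b \<mu> X j \<omega> \<longleftrightarrow>
     open \<omega> \<and> is_interval \<omega> \<and> \<omega> \<noteq> {} \<and> \<omega> \<subseteq> interior I \<and>
     (\<forall>a\<in>\<omega>. \<forall>i<j. orbit_map T X i a \<in> supp (\<mu> a) - partition_points p b a)"

definition parameter_partition ::
    "real set \<Rightarrow> (real \<Rightarrow> real \<Rightarrow> real) \<Rightarrow> (real \<Rightarrow> nat) \<Rightarrow> (real \<Rightarrow> nat \<Rightarrow> real) \<Rightarrow>
     (real \<Rightarrow> real measure) \<Rightarrow> (real \<Rightarrow> real) \<Rightarrow> nat \<Rightarrow> real set set" where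
  "parameter_partition I T p b \<mu> X j =
     {\<omega>. admissible_interval I T p b \<mu> X j \<omega> \<and>
         (\<forall>\<omega>'. admissible_interval I T p b \<mu> X j \<omega>' \<and> \<omega> \<subseteq> \<omega>' \<longrightarrow> \<omega>' = \<omega>)}"

text \<open>On \<open>\<omega>\<close> the points $x_i(a)$, $i<j$, avoid the partition and \<open>X\<close> is $C^1$, so by
  \<open>property_i\<close>, \<open>property_ii\<close> and the chain rule both derivatives below exist and \<open>deriv\<close> is not a default
  value; the denominator is nonzero because the maps are expanding.\<close>

definition condition_I ::
    "real set \<Rightarrow> (real \<Rightarrow> real \<Rightarrow> real) \<Rightarrow> (real \<Rightarrow> nat) \<Rightarrow> (real \<Rightarrow> nat \<Rightarrow> real) \<Rightarrow>
     (real \<Rightarrow> real measure) \<Rightarrow> (real \<Rightarrow> real) \<Rightarrow> bool" where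
  "condition_I I T p b \<mu> X \<longleftrightarrow>
     (\<exists>C0\<ge>1. \<forall>j\<ge>1. \<forall>\<omega>\<in>parameter_partition I T p b \<mu> X j. \<forall>a\<in>\<omega>.
        inverse C0 \<le> \<bar>deriv (orbit_map T X j) a / deriv (T a ^^ j) (X a)\<bar> \<and>
        \<bar>deriv (orbit_map T X j) a / deriv (T a ^^ j) (X a)\<bar> \<le> C0) \<and>
     (\<forall>j\<ge>1. finite (I - \<Union>(parameter_partition I T p b \<mu> X j)))"

end

theory Submission
  imports Defs
begin

text \<open>By uniqueness of the absolutely continuous invariant measure it suffices that, for almost every
  \<open>a\<close>, the orbit of \<open>X a\<close> visits every rational interval \<open>B\<close> with asymptotic frequency at most
  \<open>C |B|\<close>: every weak limit of the empirical measures then has a bounded density and does not charge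
  the discontinuities of \<open>T a\<close>, hence is invariant and equals \<open>\<mu> a\<close>.

  For the frequency bound, let \<open>\<omega>\<close> be an element of the parameter partition of level \<open>j\<close> whose end
  points are interior to \<open>I\<close>. The Markov property forces \<open>x j\<close> to map its end points to distinct
  partition points, so \<open>x j\<close> stretches \<open>\<omega>\<close> to a definite length with bounded distortion, and
  the set of \<open>a \<in> \<omega>\<close> with \<open>x j a \<in> B\<close> has measure at most \<open>C |B| |\<omega>|\<close>. Along times \<open>t i\<close> with large
  gaps the visits to \<open>B\<close> are therefore dominated by independent events of probability \<open>q = C |B|\<close>:
  the number \<open>S n\<close> of visits among the first \<open>n\<close> times satisfies
  \<open>\<integral> 2 ^ S n \<le> (1 + q) ^ n |\<omega>|\<close>, and Markov's inequality with Borel--Cantelli gives \<open>S n \<le> 2 q n\<close> eventually.\<close>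

section \<open>Regularity of the family\<close>

text \<open>Why \<open>C\<close> does not depend on \<open>B\<close>: the gap between the times
  \<open>t i\<close> must grow as \<open>B\<close> shrinks, because \<open>x (t i)\<close> has to be
  constant up to about \<open>|B|\<close> on the elements of the next level, from which the visit is
  then read off. Splitting all times into residue classes modulo the gap costs only a factor 2 for
  large \<open>n\<close>, whatever the gap is.

  The hypotheses give regularity in \<open>a\<close> and in \<open>y\<close> separately, and only
  away from the partition. The chain rule and the Lipschitz bounds along the curves
  \<open>a \<mapsto> (a, x i a)\<close> are therefore obtained in small rectangles and chained
  together.

  At an end point \<open>c\<close> of a parameter interval some \<open>x i c\<close> is a partition
  point, where \<open>T c\<close> may jump, so the orbit of \<open>c\<close> itself says nothing
  about \<open>x j\<close> on the interval. What is propagated instead is the distance to the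
  partition, for parameters inside the interval: by the Markov property the one-sided limits of
  \<open>T a\<close> at the ends of a branch are partition points, so this distance grows by a
  factor of at most \<open>Lam\<close> per step.

  Condition (I) is silent about \<open>j = 0\<close>, so the first factor of the derivative product
  is estimated crudely.\<close>

lemma mvt_deriv:
  fixes f :: "real \<Rightarrow> real"
  assumes "is_interval S" "u \<in> S" "v \<in> S" and "\<And>x. x \<in> S \<Longrightarrow> f field_differentiable at x"
  obtains z where "z \<in> S" "f v - f u = (v - u) * deriv f z"
proof -
  have *: "\<exists>z\<in>S. f v - f u = (v - u) * deriv f z" if "u \<in> S" "v \<in> S" "u < v" for u v
  proof -
    have sub: "z \<in> S" if "u \<le> z" "z \<le> v" for z
      using \<open>is_interval S\<close> \<open>u \<in> S\<close> \<open>v \<in> S\<close> that unfolding is_interval_1 by blast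
    have "\<exists>z. u < z \<and> z < v \<and> f v - f u = (v - u) * deriv f z"
      using \<open>u < v\<close> by (rule MVT2) (use sub assms(4) in \<open>simp add: DERIV_deriv_iff_field_differentiable\<close>)
    then show ?thesis using sub by (meson less_imp_le)
  qed
  consider "u < v" | "u = v" | "v < u" by linarith
  then have "\<exists>z\<in>S. f v - f u = (v - u) * deriv f z"
  proof cases
    case 3
    then obtain z where "z \<in> S" "f u - f v = (u - v) * deriv f z"
      using *[of v u] assms by blast
    then show ?thesis by (intro bexI[of _ z]) (auto simp: algebra_simps)
  qed (use * assms in auto)
  then show ?thesis using that by blast
qed

lemma nonzero_deriv_imp_monotone:
  fixes f :: "real \<Rightarrow> real"
  assumes S: "is_interval S"
    and f: "\<And>x. x \<in> S \<Longrightarrow> f field_differentiable at x" "\<And>x. x \<in> S \<Longrightarrow> deriv f x \<noteq> 0"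
  shows "strict_mono_on S f \<or> strict_antimono_on S f"
proof -
  have "continuous_on S f"
    using f(1) by (meson continuous_at_imp_continuous_on field_differentiable_imp_continuous_at)
  moreover have "inj_on f S"
  proof (rule inj_onI)
    fix u v assume uv: "u \<in> S" "v \<in> S" "f u = f v"
    obtain z where "z \<in> S" "f v - f u = (v - u) * deriv f z"
      using mvt_deriv[OF S uv(1,2) f(1)] by blast
    then show "u = v" using f(2) uv(3) by auto
  qed
  ultimately show ?thesis using injective_eq_monotone_map[OF S] by blast
qed

text \<open>Cauchy's mean value theorem carries a pointwise comparison of derivatives over to
  increments. It will compare the displacement of \<open>x i\<close>, or of the parameter itself,
  with that of a later \<open>x j\<close>.\<close>

lemma Cauchy_mvt_bound:
  fixes f g :: "real \<Rightarrow> real"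
  assumes S: "is_interval S" "u \<in> S" "v \<in> S"
    and f: "\<And>x. x \<in> S \<Longrightarrow> f field_differentiable at x"
    and g: "\<And>x. x \<in> S \<Longrightarrow> g field_differentiable at x"
    and le: "\<And>x. x \<in> S \<Longrightarrow> \<bar>deriv f x\<bar> \<le> K * \<bar>deriv g x\<bar>"
    and nz: "\<And>x. x \<in> S \<Longrightarrow> deriv g x \<noteq> 0"
  shows "\<bar>f v - f u\<bar> \<le> K * \<bar>g v - g u\<bar>"
proof -
  have *: "\<bar>f v - f u\<bar> \<le> K * \<bar>g v - g u\<bar>" if "u \<in> S" "v \<in> S" "u < v" for u v
  proof -
    have sub: "z \<in> S" if "u \<le> z" "z \<le> v" for z
      using \<open>is_interval S\<close> \<open>u \<in> S\<close> \<open>v \<in> S\<close> that unfolding is_interval_1 by blast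
    have "\<exists>c. u < c \<and> c < v \<and> (f v - f u) * deriv g c = (g v - g u) * deriv f c"
      using \<open>u < v\<close> by (rule GMVT')
        (use sub f g in \<open>auto simp: DERIV_deriv_iff_field_differentiable
           intro: field_differentiable_imp_continuous_at\<close>)
    then obtain c where c: "c \<in> S" "(f v - f u) * deriv g c = (g v - g u) * deriv f c"
      using sub by (meson less_imp_le)
    have "\<bar>f v - f u\<bar> * \<bar>deriv g c\<bar> = \<bar>g v - g u\<bar> * \<bar>deriv f c\<bar>"
      using c(2) by (metis abs_mult)
    also have "\<dots> \<le> \<bar>g v - g u\<bar> * (K * \<bar>deriv g c\<bar>)"
      using le[OF c(1)] by (intro mult_left_mono) auto
    finally have "\<bar>f v - f u\<bar> * \<bar>deriv g c\<bar> \<le> (K * \<bar>g v - g u\<bar>) * \<bar>deriv g c\<bar>"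
      by (simp add: mult_ac)
    then show ?thesis using nz[OF c(1)] by (simp add: mult_le_cancel_right)
  qed
  consider "u < v" | "u = v" | "v < u" by linarith
  then show ?thesis
  proof cases
    case 3
    then show ?thesis using *[of v u] S by (simp add: abs_minus_commute)
  qed (use * S in auto)
qed

text \<open>The bound has the form \<open>h t - h s\<close>, so it is additive under concatenation
  of intervals and bisection applies. This passes from rectangles, which are only local, to a whole
  parameter interval.\<close>

lemma increment_bound_if_locally:
  fixes g h :: "real \<Rightarrow> real"
  assumes "u \<le> v"
    and local: "\<And>x. u \<le> x \<Longrightarrow> x \<le> v \<Longrightarrow>
      \<exists>e>0. \<forall>s t. \<bar>s - x\<bar> < e \<and> \<bar>t - x\<bar> < e \<and> u \<le> s \<and> s \<le> t \<and> t \<le> v \<longrightarrow> \<bar>g t - g s\<bar> \<le> h t - h s"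
  shows "\<bar>g v - g u\<bar> \<le> h v - h u"
proof -
  have "u \<le> u \<longrightarrow> v \<le> v \<longrightarrow> \<bar>g v - g u\<bar> \<le> h v - h u"
  proof (rule Bolzano[where P = "\<lambda>s t. u \<le> s \<longrightarrow> t \<le> v \<longrightarrow> \<bar>g t - g s\<bar> \<le> h t - h s"])
    fix x assume "u \<le> x" "x \<le> v"
    then obtain e where e: "e > 0"
      "\<forall>s t. \<bar>s - x\<bar> < e \<and> \<bar>t - x\<bar> < e \<and> u \<le> s \<and> s \<le> t \<and> t \<le> v \<longrightarrow> \<bar>g t - g s\<bar> \<le> h t - h s"
      using local by blast
    show "\<exists>d>0. \<forall>s t. s \<le> x \<and> x \<le> t \<and> t - s < d \<longrightarrow> u \<le> s \<longrightarrow> t \<le> v \<longrightarrow> \<bar>g t - g s\<bar> \<le> h t - h s"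
      using e by (intro exI[of _ e]) auto
  qed (use assms(1) in auto)
  then show ?thesis by simp
qed

text \<open>The set lies in a closed interval of length \<open>r\<close> starting at its infimum. It
  need not be measurable, since monotonicity of \<open>emeasure\<close> only asks this of the larger
  set.\<close>

lemma emeasure_le_if_diameter_le:
  fixes S :: "real set"
  assumes "\<And>s t. s \<in> S \<Longrightarrow> t \<in> S \<Longrightarrow> \<bar>s - t\<bar> \<le> r" "0 \<le> r"
  shows "emeasure lborel S \<le> ennreal r"
proof (cases "S = {}")
  case False
  then obtain s where s: "s \<in> S" by blast
  have "bdd_below S"
    by (rule bdd_belowI[of _ "s - r"]) (use assms(1)[OF s] in \<open>force simp: abs_le_iff\<close>)
  have "t \<le> Inf S + r" if "t \<in> S" for t
  proof -
    have "t - r \<le> Inf S"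
      by (rule cInf_greatest[OF False]) (use assms(1)[OF that] in \<open>force simp: abs_le_iff\<close>)
    then show ?thesis by simp
  qed
  then have "S \<subseteq> {Inf S..Inf S + r}"
    using cInf_lower[OF _ \<open>bdd_below S\<close>] by auto
  then have "emeasure lborel S \<le> emeasure lborel {Inf S..Inf S + r}"
    by (intro emeasure_mono) auto
  then show ?thesis using \<open>0 \<le> r\<close> by simp
qed simp

lemma open_bounded_interval:
  fixes S :: "real set"
  assumes "open S" "is_interval S" "bounded S" "S \<noteq> {}"
  shows "S = {Inf S<..<Sup S}" "Inf S < Sup S"
proof -
  have bdd: "bdd_below S" "bdd_above S"
    using \<open>bounded S\<close> by (simp_all add: bounded_imp_bdd_below bounded_imp_bdd_above)
  have between: "Inf S < z \<and> z < Sup S" if z: "z \<in> S" for z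
  proof -
    obtain e where e: "e > 0" "ball z e \<subseteq> S" using \<open>open S\<close> z openE by blast
    then have "z - e / 2 \<in> S" "z + e / 2 \<in> S" by (auto simp: dist_real_def subset_iff)
    then show ?thesis using cInf_lower[OF _ bdd(1)] cSup_upper[OF _ bdd(2)] e(1) by force
  qed
  moreover have "z \<in> S" if z: "Inf S < z" "z < Sup S" for z
  proof -
    obtain s where "s \<in> S" "s < z" using z(1) \<open>S \<noteq> {}\<close> by (meson cInf_lessD)
    moreover obtain t where "t \<in> S" "z < t" using z(2) \<open>S \<noteq> {}\<close> by (meson less_cSupE)
    ultimately show ?thesis using mem_is_interval_1_I[OF \<open>is_interval S\<close>, of s t z] by simp
  qed
  ultimately show "S = {Inf S<..<Sup S}" by auto
  then show "Inf S < Sup S" using \<open>S \<noteq> {}\<close> by force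
qed

text \<open>The gap in property (i) and the ratio bound in condition (I), which are existentially
  quantified there, become the parameters \<open>\<delta>0\<close> and \<open>C0\<close>, so that
  further constants can be defined from them.\<close>

locale markov_family = piecewise_expanding_family +
  fixes p0 :: nat and X :: "real \<Rightarrow> real" and C0 \<delta>0 :: real
  assumes p_eq: "\<And>a. a \<in> I \<Longrightarrow> p a = p0"
    and b_lipschitz: "\<And>k. k \<le> p0 \<Longrightarrow> L-lipschitz_on I (\<lambda>a. b a k)"
    and \<delta>0_pos: "0 < \<delta>0"
    and b_gap: "\<And>a k. a \<in> I \<Longrightarrow> k \<in> {1..p0} \<Longrightarrow> \<delta>0 \<le> b a k - b a (k - 1)"
    and property_ii: "property_ii I L T b p0"
    and property_iii: "property_iii I p b \<mu>"
    and markov: "markov_property I T b p0"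
    and X_unit: "X \<in> I \<rightarrow> {0..1}" and X_C1: "C1_on I X"
    and C0_ge_1: "1 \<le> C0"
    and derivative_ratio: "\<And>j \<omega> a. 1 \<le> j \<Longrightarrow> \<omega> \<in> parameter_partition I T p b \<mu> X j \<Longrightarrow> a \<in> \<omega> \<Longrightarrow>
        inverse C0 \<le> \<bar>deriv (orbit_map T X j) a / deriv (T a ^^ j) (X a)\<bar> \<and>
        \<bar>deriv (orbit_map T X j) a / deriv (T a ^^ j) (X a)\<bar> \<le> C0"
    and finite_exceptions: "\<And>j. 1 \<le> j \<Longrightarrow> finite (I - \<Union>(parameter_partition I T p b \<mu> X j))"
begin

abbreviation "x \<equiv> orbit_map T X"
abbreviation "P \<equiv> parameter_partition I T p b \<mu> X"
abbreviation "Br \<equiv> branch_interval b"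
abbreviation "Pt \<equiv> partition_points p b"

section \<open>Partition points, branches and derivative bounds at a fixed parameter\<close>

lemma lam_pos: "0 < lam" and Lam_pos: "0 < Lam"
  using constants by auto

lemma b_0: "a \<in> I \<Longrightarrow> b a 0 = 0" and b_p0: "a \<in> I \<Longrightarrow> b a p0 = 1"
  using partition_ends p_eq by auto

lemma Pt_eq: "a \<in> I \<Longrightarrow> Pt a = b a ` {..p0}"
  unfolding partition_points_def using p_eq by simp

lemma b_separated:
  assumes "a \<in> I" "k < l" "l \<le> p0"
  shows "\<delta>0 \<le> b a l - b a k"
  using assms(2,3)
proof (induction l)
  case (Suc l)
  have step: "\<delta>0 \<le> b a (Suc l) - b a l"
    using b_gap[OF assms(1), of "Suc l"] Suc.prems by simp
  show ?case
  proof (cases "k = l")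
    case False
    then show ?thesis using Suc step \<delta>0_pos by force
  qed (use step in simp)
qed simp

lemma b_mono: "a \<in> I \<Longrightarrow> k \<le> l \<Longrightarrow> l \<le> p0 \<Longrightarrow> b a k \<le> b a l"
  using b_separated[of a k l] \<delta>0_pos by (cases "k = l") auto

lemma b_unit: "a \<in> I \<Longrightarrow> k \<le> p0 \<Longrightarrow> b a k \<in> {0..1}"
  using b_mono[of a 0 k] b_mono[of a k p0] b_0 b_p0 by auto

lemma not_partition_if_branch:
  assumes "a \<in> I" "k \<in> {1..p0}" "y \<in> Br a k" "l \<le> p0"
  shows "b a l \<noteq> y"
proof (cases "l \<le> k - 1")
  case True
  then show ?thesis using b_mono[OF assms(1) True] assms by (force simp: branch_interval_def)
next
  case False
  then have "k \<le> l" by auto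
  then show ?thesis using b_mono[OF assms(1) \<open>k \<le> l\<close>] assms by (force simp: branch_interval_def)
qed

lemma branch_subset:
  assumes "a \<in> I" "k \<in> {1..p0}"
  shows "Br a k \<subseteq> {0..1} - Pt a"
proof
  fix y assume y: "y \<in> Br a k"
  then have "y \<notin> Pt a" using not_partition_if_branch[OF assms] by (auto simp: Pt_eq[OF assms(1)])
  moreover have "b a k \<in> {0..1}" "b a (k - 1) \<in> {0..1}"
    using b_unit[OF assms(1)] assms(2) by (metis atLeastAtMost_iff diff_le_self le_trans)+
  then have "y \<in> {0..1}" using y by (simp add: branch_interval_def)
  ultimately show "y \<in> {0..1} - Pt a" by blast
qed

lemma branch_exists:
  assumes "a \<in> I" "y \<in> {0..1} - Pt a"
  obtains k where "k \<in> {1..p0}" "y \<in> Br a k"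
proof -
  have ne: "b a k \<noteq> y" if "k \<le> p0" for k using assms that by (auto simp: Pt_eq)
  have top: "y < b a p0" using assms b_p0 ne[of p0] by force
  define k where "k = (LEAST k. y < b a k)"
  have k: "y < b a k" and least: "\<And>l. l < k \<Longrightarrow> b a l \<le> y"
    unfolding k_def using top by (auto intro: LeastI dest: not_less_Least)
  have "k \<le> p0" unfolding k_def using top by (rule Least_le)
  moreover have "k \<noteq> 0" using k assms b_0 by (metis DiffD1 atLeastAtMost_iff not_le)
  ultimately have k_in: "k \<in> {1..p0}" by simp
  then have "b a (k - 1) \<le> y" "b a (k - 1) \<noteq> y"
    using least[of "k - 1"] ne[of "k - 1"] \<open>k \<le> p0\<close> by auto
  then have "y \<in> Br a k" using k by (simp add: branch_interval_def)
  with k_in show ?thesis using that by blast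
qed

lemma
  assumes "a \<in> I" "k \<in> {1..p0}"
  shows T_differentiable: "y \<in> Br a k \<Longrightarrow> T a field_differentiable at y"
    and deriv_T_lipschitz: "L-lipschitz_on (Br a k) (deriv (T a))"
proof -
  obtain f' where f': "\<forall>y\<in>Br a k. (T a has_real_derivative f' y) (at y within Br a k)"
      "L-lipschitz_on (Br a k) f'"
    using branches_C11[of a k] assms p_eq unfolding C11_on_def by metis
  have "open (Br a k)" by (simp add: branch_interval_def)
  then have der: "(T a has_real_derivative f' y) (at y)" if "y \<in> Br a k" for y
    using f'(1) that at_within_open by metis
  then show "y \<in> Br a k \<Longrightarrow> T a field_differentiable at y"
    using field_differentiable_def by blast
  show "L-lipschitz_on (Br a k) (deriv (T a))"
    using f'(2) DERIV_imp_deriv[OF der] unfolding lipschitz_on_def by simp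
qed

lemma deriv_T_bounds:
  assumes "a \<in> I" "y \<in> {0..1} - Pt a"
  shows "lam \<le> \<bar>deriv (T a) y\<bar>" "\<bar>deriv (T a) y\<bar> \<le> Lam"
  using expanding[OF assms] by auto

text \<open>Rectangles in the \<open>(a, y)\<close>-plane that stay inside one branch. On them the regularity in \<open>a\<close>
  and in \<open>y\<close> separately gives joint regularity.\<close>

definition box :: "real \<Rightarrow> nat \<Rightarrow> real \<Rightarrow> real \<Rightarrow> bool" where
  "box a k y r \<longleftrightarrow> 0 < r \<and> k \<in> {1..p0} \<and> (\<forall>a'\<in>ball a r. a' \<in> I \<and> ball y r \<subseteq> Br a' k)"

lemma boxD:
  assumes "box a k y r"
  shows "0 < r" "k \<in> {1..p0}" "ball a r \<subseteq> I"
    and "s \<in> ball a r \<Longrightarrow> z \<in> ball y r \<Longrightarrow> z \<in> Br s k"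
proof -
  show "0 < r" "k \<in> {1..p0}" using assms by (simp_all add: box_def)
  show "ball a r \<subseteq> I" using assms by (auto simp only: box_def)
  show "z \<in> Br s k" if "s \<in> ball a r" "z \<in> ball y r"
    using assms that unfolding box_def by (meson subsetD)
qed

lemma box_exists:
  assumes "a \<in> interior I" "k \<in> {1..p0}" "y \<in> Br a k"
  obtains r where "box a k y r"
proof -
  obtain r0 where r0: "r0 > 0" "ball a r0 \<subseteq> I"
    using assms(1) mem_interior by blast
  define e where "e = min (y - b a (k - 1)) (b a k - y)"
  have e: "e > 0" "b a (k - 1) + e \<le> y" "y + e \<le> b a k"
    using assms(3) by (auto simp: branch_interval_def e_def)
  have L1: "L + 1 > 0" using constants by simp
  \<comment> \<open>While \<open>a'\<close> ranges over a ball of radius \<open>r\<close>, the ends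
    of the branch move by at most \<open>L * r\<close>. With \<open>(L + 1) * r \<le> e\<close> a
    whole ball of radius \<open>r\<close> around \<open>y\<close> still fits between them.\<close>
  define r where "r = min r0 (e / (L + 1))"
  have r: "r > 0" "r \<le> r0" using r0 e L1 by (auto simp: r_def)
  have "r * (L + 1) \<le> e"
    using L1 by (simp add: r_def pos_le_divide_eq[symmetric])
  then have re: "L * r + r \<le> e" by (simp add: algebra_simps)
  have "a' \<in> I \<and> ball y r \<subseteq> Br a' k" if a': "a' \<in> ball a r" for a'
  proof
    show "a' \<in> I" using a' r0 r by auto
    have aI: "a \<in> I" using assms(1) interior_subset by blast
    have near: "\<bar>b a' l - b a l\<bar> \<le> L * r" if "l \<le> p0" for l
    proof -
      have "\<bar>b a' l - b a l\<bar> \<le> L * \<bar>a' - a\<bar>"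
        using lipschitz_onD[OF b_lipschitz[OF that] \<open>a' \<in> I\<close> aI] by (simp add: dist_real_def)
      also have "\<dots> \<le> L * r"
        using a' constants by (intro mult_left_mono) (auto simp: dist_real_def)
      finally show ?thesis .
    qed
    show "ball y r \<subseteq> Br a' k"
    proof
      fix z assume "z \<in> ball y r"
      then show "z \<in> Br a' k"
        using near[of k] near[of "k - 1"] assms(2) re e le_trans[OF diff_le_self]
        by (auto simp: branch_interval_def dist_real_def abs_le_iff abs_less_iff)
    qed
  qed
  then have "box a k y r" using r assms(2) by (simp add: box_def)
  then show ?thesis using that by blast
qed

lemma property_ii_box:
  assumes "box a k y r" "z \<in> ball y r"
  shows "C1_on (ball a r) (\<lambda>a. T a z)" "L-lipschitz_on (ball a r) (\<lambda>a. deriv (T a) z)"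
proof -
  note sub = boxD(3)[OF assms(1)] and z = boxD(4)[OF assms(1) _ assms(2)]
  have "a \<in> ball a r" using boxD(1)[OF assms(1)] by simp
  then have "z \<in> {0..1}" using z branch_subset boxD(2)[OF assms(1)] sub by blast
  moreover have "\<forall>a'\<in>ball a r. \<forall>l\<le>p0. b a' l \<noteq> z"
    using z not_partition_if_branch sub boxD(2)[OF assms(1)] by blast
  moreover have "is_interval (ball a r)" by (simp add: is_interval_ball_real)
  ultimately show "C1_on (ball a r) (\<lambda>a. T a z)" "L-lipschitz_on (ball a r) (\<lambda>a. deriv (T a) z)"
    using property_ii sub unfolding property_ii_def by blast+
qed

text \<open>Two legs: from \<open>(s, z)\<close> to \<open>(s, w)\<close> inside one branch of
  \<open>T s\<close>, then from \<open>(s, w)\<close> to \<open>(t, w)\<close> by property (ii),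
  both staying in the rectangle.\<close>

lemma deriv_T_box:
  assumes "box a k y r" "s \<in> ball a r" "t \<in> ball a r" "z \<in> ball y r" "w \<in> ball y r"
  shows "\<bar>deriv (T s) z - deriv (T t) w\<bar> \<le> L * \<bar>s - t\<bar> + L * \<bar>z - w\<bar>"
proof -
  have "s \<in> I" "z \<in> Br s k" "w \<in> Br s k" "k \<in> {1..p0}"
    using boxD[OF assms(1)] assms by blast+
  then have "\<bar>deriv (T s) z - deriv (T s) w\<bar> \<le> L * \<bar>z - w\<bar>"
    using lipschitz_onD[OF deriv_T_lipschitz] by (simp add: dist_real_def)
  moreover have "\<bar>deriv (T s) w - deriv (T t) w\<bar> \<le> L * \<bar>s - t\<bar>"
    using lipschitz_onD[OF property_ii_box(2)[OF assms(1,5)] assms(2,3)] by (simp add: dist_real_def)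
  ultimately show ?thesis by linarith
qed

text \<open>A chain rule without joint differentiability. Write \<open>T s (y s)\<close> as
  \<open>T s (y a)\<close>, which property (ii) handles, plus \<open>T s (y s) - T s (y a)\<close>.
  By the mean value theorem the latter is \<open>y s - y a\<close> times a derivative of
  \<open>T s\<close> at an intermediate point, and that derivative tends to
  \<open>deriv (T a) (y a)\<close> by \<open>deriv_T_box\<close>.\<close>

lemma T_comp_differentiable:
  assumes a: "a \<in> interior I" and k: "k \<in> {1..p0}" "y a \<in> Br a k"
    and y: "y field_differentiable at a"
  shows "(\<lambda>a. T a (y a)) field_differentiable at a"
proof -
  obtain r where r: "box a k (y a) r" using box_exists[OF a k] .
  have r0: "r > 0" using r by (simp add: box_def)
  \<comment> \<open>A slope in Caratheodory's sense. Where \<open>y s = y a\<close> the quotient is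
    meaningless, and the value chosen there is the limit, which keeps \<open>D\<close> continuous at
    \<open>a\<close> however often \<open>y\<close> returns to \<open>y a\<close>.\<close>
  define D where "D s = (if y s = y a then deriv (T a) (y a)
      else (T s (y s) - T s (y a)) / (y s - y a))" for s
  obtain q where q: "\<And>s. y s - y a = q s * (s - a)" "isCont q a"
    using y unfolding field_differentiable_def CARAT_DERIV by blast
  have ycont: "isCont y a" using y by (rule field_differentiable_imp_continuous_at)
  have bound: "\<bar>D s - D a\<bar> \<le> L * \<bar>s - a\<bar> + L * \<bar>y s - y a\<bar>" if s: "s \<in> ball a r" "y s \<in> ball (y a) r" for s
  proof (cases "y s = y a")
    case True
    then show ?thesis using constants by (simp add: D_def)
  next
    case False
    have "T s field_differentiable at z" if "z \<in> ball (y a) r" for z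
    proof -
      have "z \<in> Br s k" "s \<in> I" "k \<in> {1..p0}" using boxD[OF r] s that by blast+
      then show ?thesis by (rule T_differentiable[rotated 2])
    qed
    moreover have "closed_segment (y a) (y s) \<subseteq> ball (y a) r"
      using s r0 by (simp add: closed_segment_subset)
    moreover have "is_interval (closed_segment (y a) (y s))"
      by (simp add: is_interval_convex_1)
    ultimately obtain z where z: "z \<in> closed_segment (y a) (y s)"
        "T s (y s) - T s (y a) = (y s - y a) * deriv (T s) z"
      using mvt_deriv[of "closed_segment (y a) (y s)" "y a" "y s" "T s"] by (metis ends_in_segment subsetD)
    have "D s = deriv (T s) z" using z(2) False by (simp add: D_def)
    moreover have "\<bar>deriv (T s) z - deriv (T a) (y a)\<bar> \<le> L * \<bar>s - a\<bar> + L * \<bar>z - y a\<bar>"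
      using deriv_T_box[OF r s(1), of a z "y a"] z(1) \<open>closed_segment _ _ \<subseteq> _\<close> r0 by auto
    moreover have "\<bar>z - y a\<bar> \<le> \<bar>y s - y a\<bar>"
      using z(1) by (auto simp: closed_segment_eq_real_ivl split: if_splits)
    then have "L * \<bar>z - y a\<bar> \<le> L * \<bar>y s - y a\<bar>" using constants by simp
    ultimately show ?thesis by (simp add: D_def)
  qed
  have "isCont D a"
    unfolding isCont_def
  proof (rule tendsto_rabs_zero_cancel[THEN LIM_zero_cancel], rule tendsto_sandwich[OF _ _ tendsto_const])
    show "\<forall>\<^sub>F s in at a. \<bar>D s - D a\<bar> \<le> L * \<bar>s - a\<bar> + L * \<bar>y s - y a\<bar>"
    proof -
      have "\<forall>\<^sub>F s in at a. y s \<in> ball (y a) r"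
        using ycont r0 unfolding isCont_def by (metis centre_in_ball open_ball topological_tendstoD)
      moreover have "\<forall>\<^sub>F s in at a. s \<in> ball a r"
        using r0 by (intro eventually_at_in_open') auto
      ultimately show ?thesis by eventually_elim (rule bound)
    qed
    show "((\<lambda>s. L * \<bar>s - a\<bar> + L * \<bar>y s - y a\<bar>) \<longlongrightarrow> 0) (at a)"
      using ycont[unfolded isCont_def] by (auto intro!: tendsto_eq_intros)
  qed simp
  moreover have "T s (y s) - T s (y a) = D s * q s * (s - a)" for s
  proof (cases "y s = y a")
    case True
    then show ?thesis using q(1)[of s] by (auto simp: D_def)
  next
    case False
    then have "T s (y s) - T s (y a) = D s * (y s - y a)" by (simp add: D_def)
    then show ?thesis using q(1)[of s] by simp
  qed
  ultimately have "((\<lambda>s. T s (y s) - T s (y a)) has_real_derivative D a * q a) (at a)"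
    unfolding CARAT_DERIV using q(2) by (intro exI[of _ "\<lambda>s. D s * q s"]) auto
  then have d1: "(\<lambda>s. T s (y s) - T s (y a)) field_differentiable at a"
    using field_differentiable_def by blast
  have "C1_on (ball a r) (\<lambda>s. T s (y a))"
    using property_ii_box(1)[OF r] r0 by simp
  then obtain f' where "((\<lambda>s. T s (y a)) has_real_derivative f' a) (at a within ball a r)"
    using r0 unfolding C1_on_def by (meson centre_in_ball)
  then have d2: "(\<lambda>s. T s (y a)) field_differentiable at a"
    using r0 at_within_open[of a "ball a r"] by (auto simp: field_differentiable_def)
  show ?thesis
    using field_differentiable_add[OF d1 d2] by simp
qed

section \<open>Differentiability of the orbit maps in the parameter and in the initial point\<close>

lemma x_Suc: "x (Suc i) a = T a (x i a)" and x_0: "x 0 a = X a"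
  by (simp_all add: orbit_map_def)

lemma x_unit: "a \<in> I \<Longrightarrow> x i a \<in> {0..1}"
  unfolding orbit_map_def using self_map X_unit by (intro funpow_unit_interval) auto

lemma x_differentiable:
  assumes "a \<in> interior I" "\<And>i. i < j \<Longrightarrow> x i a \<notin> Pt a"
  shows "x j field_differentiable at a"
  using assms(2)
proof (induction j)
  case 0
  obtain f' where "(X has_real_derivative f') (at a within I)"
    using X_C1 assms(1) interior_subset unfolding C1_on_def by blast
  then have "(X has_real_derivative f') (at a)"
    by (simp add: at_within_interior[OF assms(1)])
  then have "X field_differentiable at a" using field_differentiable_def by blast
  moreover have "x 0 = X" by (rule ext) (rule x_0)
  ultimately show ?case by simp
next
  case (Suc j)
  have aI: "a \<in> I" using assms(1) interior_subset by blast
  have "x j a \<in> {0..1} - Pt a" using Suc.prems x_unit[OF aI] by auto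
  then obtain k where "k \<in> {1..p0}" "x j a \<in> Br a k" using branch_exists[OF aI] by blast
  then have "(\<lambda>a. T a (x j a)) field_differentiable at a"
    using assms(1) Suc by (intro T_comp_differentiable) auto
  moreover have "x (Suc j) = (\<lambda>a. T a (x j a))" by (rule ext) (rule x_Suc)
  ultimately show ?case by simp
qed

lemma deriv_funpow_T:
  assumes "a \<in> I" "\<And>i. i < j \<Longrightarrow> x i a \<notin> Pt a"
  shows "((T a ^^ j) has_real_derivative (\<Prod>i<j. deriv (T a) (x i a))) (at (X a))"
  using assms(2)
proof (induction j)
  case (Suc j)
  have "x j a \<in> {0..1} - Pt a" using Suc.prems x_unit[OF assms(1)] by auto
  then obtain k where "k \<in> {1..p0}" "x j a \<in> Br a k" using branch_exists[OF assms(1)] by blast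
  then have "T a field_differentiable at (x j a)" using T_differentiable assms(1) by blast
  then have "(T a has_real_derivative deriv (T a) (x j a)) (at ((T a ^^ j) (X a)))"
    by (simp add: DERIV_deriv_iff_field_differentiable orbit_map_def)
  moreover have "((T a ^^ j) has_real_derivative (\<Prod>i<j. deriv (T a) (x i a))) (at (X a))"
    using Suc by simp
  ultimately have "(T a \<circ> T a ^^ j has_real_derivative
      deriv (T a) (x j a) * (\<Prod>i<j. deriv (T a) (x i a))) (at (X a))"
    by (rule DERIV_chain)
  then show ?case by (simp add: mult.commute o_def)
qed (simp add: id_def)

end

section \<open>Images of branches and bounded distortion\<close>

text \<open>Passing from \<open>j\<close> to \<open>Suc j\<close> replaces the sum \<open>S\<close>
  by \<open>(S + 1) / c\<close>, and \<open>1 / (c - 1)\<close> is the fixed point of this map. A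
  bound independent of \<open>j\<close> is what makes the distortion constant uniform.\<close>

lemma sum_inverse_power_le:
  fixes c :: real
  assumes "1 < c"
  shows "(\<Sum>i<j. 1 / c ^ (j - i)) \<le> 1 / (c - 1)"
proof (induction j)
  case (Suc j)
  have "(\<Sum>i<Suc j. 1 / c ^ (Suc j - i)) = (\<Sum>i<j. 1 / c ^ (j - i)) / c + 1 / c"
    by (simp add: sum_divide_distrib Suc_diff_le mult.commute)
  also have "\<dots> \<le> (1 / (c - 1)) / c + 1 / c"
    using Suc assms by (intro add_right_mono divide_right_mono) auto
  also have "\<dots> = 1 / (c - 1)"
    using assms by (simp add: field_simps)
  finally show ?case .
qed (use assms in simp)

context markov_family
begin

lemma branch_unique:
  assumes "a \<in> I" "k \<in> {1..p0}" "l \<in> {1..p0}" "y \<in> Br a k" "y \<in> Br a l"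
  shows "k = l"
proof -
  have *: False if "k \<in> {1..p0}" "l \<in> {1..p0}" "y \<in> Br a k" "y \<in> Br a l" "k < l" for k l
  proof -
    have "b a k \<le> b a (l - 1)" using that by (intro b_mono assms) auto
    then show False using that by (auto simp: branch_interval_def)
  qed
  show ?thesis using *[of k l] *[of l k] assms by (metis linorder_neqE_nat)
qed

text \<open>Up to finitely many points the image of a branch either contains or misses all of the
  branch interval around \<open>y\<close>, so it cannot switch from one to the other at
  \<open>y\<close>.\<close>

lemma markov_no_cut:
  assumes a: "a \<in> I" and k: "k \<in> {1..p0}" and y: "y \<in> {0..1} - Pt a" and e: "0 < e"
  defines "S \<equiv> T a ` Br a k"
  shows "\<not> ({y - e<..<y} \<subseteq> S \<and> {y<..<y + e} \<inter> S = {})"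
    and "\<not> ({y<..<y + e} \<subseteq> S \<and> {y - e<..<y} \<inter> S = {})"
proof -
  obtain m where m: "m \<in> {1..p0}" "y \<in> Br a m" using branch_exists[OF a y] .
  obtain M where M: "M \<subseteq> {1..p0}" "finite (sym_diff S (\<Union>l\<in>M. Br a l))"
    using markov a k unfolding markov_property_def S_def by blast
  \<comment> \<open>Depending on whether the branch \<open>m\<close> belongs to the union, one of
    the infinite sets \<open>V\<close> and \<open>U\<close> lies in the finite symmetric
    difference.\<close>
  have *: False if "U \<subseteq> S" "V \<inter> S = {}" "infinite U" "infinite V" "U \<subseteq> Br a m" "V \<subseteq> Br a m" for U V
  proof (cases "m \<in> M")
    case True
    then have "V \<subseteq> sym_diff S (\<Union>l\<in>M. Br a l)" using that by blast
    then show False using M(2) that finite_subset by blast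
  next
    case False
    then have "Br a m \<inter> (\<Union>l\<in>M. Br a l) = {}" using branch_unique[OF a m(1)] M(1) by blast
    then have "U \<subseteq> sym_diff S (\<Union>l\<in>M. Br a l)" using that by blast
    then show False using M(2) that finite_subset by blast
  qed
  define d where "d = min e (min (y - b a (m - 1)) (b a m - y))"
  have d: "d > 0" "d \<le> e" using m e by (auto simp: d_def branch_interval_def)
  have sub: "{y - d<..<y} \<subseteq> Br a m" "{y<..<y + d} \<subseteq> Br a m"
    by (auto simp: d_def branch_interval_def)
  have inf: "infinite {y - d<..<y}" "infinite {y<..<y + d}" using d by (auto simp: infinite_Ioo)
  have sub': "{y - d<..<y} \<subseteq> {y - e<..<y}" "{y<..<y + d} \<subseteq> {y<..<y + e}" using d by auto
  show "\<not> ({y - e<..<y} \<subseteq> S \<and> {y<..<y + e} \<inter> S = {})"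
    using *[OF _ _ inf sub] sub' by blast
  show "\<not> ({y<..<y + e} \<subseteq> S \<and> {y - e<..<y} \<inter> S = {})"
    using *[OF _ _ inf(2,1) sub(2,1)] sub' by blast
qed

lemma T_branch_increment:
  assumes "a \<in> I" "k \<in> {1..p0}" "y \<in> Br a k" "z \<in> Br a k"
  shows "\<bar>T a z - T a y\<bar> \<le> Lam * \<bar>z - y\<bar>"
proof -
  obtain w where w: "w \<in> Br a k" "T a z - T a y = (z - y) * deriv (T a) w"
    using mvt_deriv[of "Br a k" y z "T a"] assms T_differentiable
    by (auto simp: branch_interval_def is_interval_oo)
  have "\<bar>deriv (T a) w\<bar> \<le> Lam" using deriv_T_bounds assms w(1) branch_subset by blast
  then have "\<bar>z - y\<bar> * \<bar>deriv (T a) w\<bar> \<le> \<bar>z - y\<bar> * Lam" by (intro mult_left_mono) auto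
  then show ?thesis using w(2) by (simp add: abs_mult mult.commute)
qed

lemma T_branch_monotone:
  assumes "a \<in> I" "k \<in> {1..p0}"
  shows "strict_mono_on (Br a k) (T a) \<or> strict_antimono_on (Br a k) (T a)"
proof (rule nonzero_deriv_imp_monotone)
  show "is_interval (Br a k)" by (simp add: branch_interval_def is_interval_oo)
  show "T a field_differentiable at y" if "y \<in> Br a k" for y
    using T_differentiable assms that by blast
  show "deriv (T a) y \<noteq> 0" if "y \<in> Br a k" for y
  proof -
    have "lam \<le> \<bar>deriv (T a) y\<bar>" using deriv_T_bounds(1) assms that branch_subset by blast
    then show ?thesis using lam_pos by auto
  qed
qed

text \<open>The image is an interval with more than one point, so it fills a one-sided neighbourhood
  of its supremum and misses the other side. By \<open>markov_no_cut\<close> this happens only at a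
  partition point, and likewise for the infimum.\<close>

lemma T_branch_image_ends:
  assumes a: "a \<in> I" and k: "k \<in> {1..p0}"
  shows "Sup (T a ` Br a k) \<in> Pt a" "Inf (T a ` Br a k) \<in> Pt a"
    and "bdd_above (T a ` Br a k)" "bdd_below (T a ` Br a k)"
proof -
  define S where "S = T a ` Br a k"
  have S01: "S \<subseteq> {0..1}" using branch_subset[OF a k] self_map[OF a] by (auto simp: S_def)
  then show bdd: "bdd_above (T a ` Br a k)" "bdd_below (T a ` Br a k)"
    unfolding S_def by (meson bdd_above_Icc bdd_below_Icc bdd_above_mono bdd_below_mono)+
  have "continuous_on (Br a k) (T a)"
    using T_differentiable[OF a k]
    by (meson continuous_at_imp_continuous_on field_differentiable_imp_continuous_at)
  then have "is_interval S"
    unfolding S_def is_interval_connected_1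
    by (rule connected_continuous_image) (simp add: branch_interval_def)
  have "b a (k - 1) < b a k" using b_gap[OF a k] \<delta>0_pos by simp
  then obtain u v where uv: "u \<in> Br a k" "v \<in> Br a k" "u < v"
  proof -
    define d where "d = b a k - b a (k - 1)"
    have "d > 0" using \<open>b a (k - 1) < b a k\<close> by (simp add: d_def)
    moreover have "b a k = b a (k - 1) + d" by (simp add: d_def)
    ultimately have "b a (k - 1) + d / 3 \<in> Br a k" "b a (k - 1) + d / 2 \<in> Br a k"
        "b a (k - 1) + d / 3 < b a (k - 1) + d / 2"
      by (simp_all add: branch_interval_def)
    then show ?thesis using that by blast
  qed
  have "T a u \<noteq> T a v"
    using T_branch_monotone[OF a k] uv by (auto dest: monotone_onD)
  then obtain s t where st: "s \<in> S" "t \<in> S" "s < t"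
    using uv by (metis S_def imageI linorder_neqE_linordered_idom)
  have up: "z \<le> Sup S" and low: "Inf S \<le> z" if "z \<in> S" for z
    using that bdd by (auto simp: S_def intro: cSup_upper cInf_lower)
  have SI: "Sup S \<in> {0..1}" "Inf S \<in> {0..1}"
    using S01 st up[OF st(1)] low[OF st(1)]
    by (auto intro!: cSup_least cInf_greatest intro: order_trans)
  have "{Sup S - (Sup S - s)<..<Sup S} \<subseteq> S"
  proof
    fix z assume z: "z \<in> {Sup S - (Sup S - s)<..<Sup S}"
    then obtain w where "w \<in> S" "z < w" using less_cSupE[of z S] st by auto
    moreover have "s \<le> z" using z by simp
    ultimately show "z \<in> S" using mem_is_interval_1_I[OF \<open>is_interval S\<close> st(1)] by simp
  qed
  moreover have "{Sup S<..<Sup S + (Sup S - s)} \<inter> S = {}" using up by force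
  ultimately show "Sup (T a ` Br a k) \<in> Pt a"
    using markov_no_cut(1)[OF a k, of "Sup S" "Sup S - s"] SI up[OF st(2)] st(3) unfolding S_def by auto
  have "{Inf S<..<Inf S + (t - Inf S)} \<subseteq> S"
  proof
    fix z assume z: "z \<in> {Inf S<..<Inf S + (t - Inf S)}"
    then obtain w where "w \<in> S" "w < z" using cInf_lessD[of S z] st by auto
    moreover have "z \<le> t" using z by simp
    ultimately show "z \<in> S" using mem_is_interval_1_I[OF \<open>is_interval S\<close> _ st(2)] by simp
  qed
  moreover have "{Inf S - (t - Inf S)<..<Inf S} \<inter> S = {}" using low by force
  ultimately show "Inf (T a ` Br a k) \<in> Pt a"
    using markov_no_cut(2)[OF a k, of "Inf S" "t - Inf S"] SI low[OF st(1)] st(3) unfolding S_def by auto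
qed

text \<open>Going from \<open>y\<close> towards \<open>b a m\<close>, one reaches the end of the
  branch of \<open>y\<close> no later than \<open>b a m\<close>, so the image moves by at most
  \<open>Lam * \<bar>y - b a m\<bar>\<close> on the way. The image ends there at a partition point.
  Its index \<open>m'\<close> is in general unrelated to \<open>m\<close>.\<close>

lemma T_near_partition_step:
  assumes a: "a \<in> I" and y: "y \<in> {0..1} - Pt a" and m: "m \<le> p0"
  shows "\<exists>m'\<le>p0. \<bar>T a y - b a m'\<bar> \<le> Lam * \<bar>y - b a m\<bar>"
proof -
  obtain k where k: "k \<in> {1..p0}" "y \<in> Br a k" using branch_exists[OF a y] .
  define S where "S = T a ` Br a k"
  define d where "d = Lam * \<bar>y - b a m\<bar>"
  have TyS: "T a y \<in> S" using k by (simp add: S_def)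
  note ends = T_branch_image_ends[OF a k(1), folded S_def]
  have side: "m \<le> k - 1 \<or> k \<le> m" using k by auto
  have near: "\<bar>T a z - T a y\<bar> \<le> d" if "z \<in> Br a k" "y \<le> z \<and> k \<le> m \<or> z \<le> y \<and> m \<le> k - 1" for z
  proof -
    have "\<bar>z - y\<bar> \<le> \<bar>y - b a m\<bar>"
      using that(2)
    proof
      assume "y \<le> z \<and> k \<le> m"
      then show ?thesis using that(1) b_mono[OF a _ m, of k] by (auto simp: branch_interval_def)
    next
      assume h: "z \<le> y \<and> m \<le> k - 1"
      then have "b a m \<le> b a (k - 1)" using k by (intro b_mono a) auto
      then show ?thesis using that(1) h by (auto simp: branch_interval_def)
    qed
    then have "Lam * \<bar>z - y\<bar> \<le> d" using Lam_pos by (simp add: d_def)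
    then show ?thesis using T_branch_increment[OF a k that(1)] by linarith
  qed
  have d0: "0 \<le> d" using Lam_pos by (simp add: d_def)
  \<comment> \<open>If \<open>T a\<close> rises in the direction of \<open>b a m\<close>, the points
    on that side have images at most \<open>T a y + d\<close> and those on the other side have
    images below \<open>T a y\<close>. If it falls, the inequalities are reversed. Hence either the
    supremum or the infimum of the image is within \<open>d\<close> of \<open>T a y\<close>.\<close>
  consider "\<forall>s\<in>S. s \<le> T a y + d" | "\<forall>s\<in>S. T a y - d \<le> s"
  proof -
    have "(\<forall>z\<in>Br a k. T a z \<le> T a y + d) \<or> (\<forall>z\<in>Br a k. T a y - d \<le> T a z)"
    proof -
      have split: "(\<forall>z\<in>Br a k. z < y \<longrightarrow> T a z < T a y) \<and> (\<forall>z\<in>Br a k. y < z \<longrightarrow> T a y < T a z) \<or>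
          (\<forall>z\<in>Br a k. z < y \<longrightarrow> T a y < T a z) \<and> (\<forall>z\<in>Br a k. y < z \<longrightarrow> T a z < T a y)"
        using T_branch_monotone[OF a k(1)] k(2) by (meson monotone_onD)
      have le: "T a z \<le> T a y + d \<and> T a y - d \<le> T a z"
        if "z \<in> Br a k" "y \<le> z \<and> k \<le> m \<or> z \<le> y \<and> m \<le> k - 1" for z
        using near[OF that] by linarith
      show ?thesis using split side
      proof (elim disjE)
      qed (use le d0 in \<open>metis add_increasing2 diff_le_eq le_add_same_cancel1 less_imp_le linorder_not_le order_trans\<close>)+
    qed
    then show ?thesis using that unfolding S_def by blast
  qed
  then obtain \<tau> where "\<tau> \<in> Pt a" "\<bar>T a y - \<tau>\<bar> \<le> d"
  proof cases
    case 1
    then have "Sup S \<le> T a y + d" using TyS by (intro cSup_least) auto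
    moreover have "T a y \<le> Sup S" using TyS ends(3) by (rule cSup_upper)
    ultimately show ?thesis using that[OF ends(1)] by auto
  next
    case 2
    then have "T a y - d \<le> Inf S" using TyS by (intro cInf_greatest) auto
    moreover have "Inf S \<le> T a y" using TyS ends(4) by (rule cInf_lower)
    ultimately show ?thesis using that[OF ends(2)] by auto
  qed
  then show ?thesis using Pt_eq[OF a] unfolding d_def by auto
qed

lemma x_near_partition:
  assumes a: "a \<in> I" and m: "m \<le> p0" and off: "\<And>l. i \<le> l \<Longrightarrow> l < i + n \<Longrightarrow> x l a \<notin> Pt a"
  shows "\<exists>m'\<le>p0. \<bar>x (i + n) a - b a m'\<bar> \<le> Lam ^ n * \<bar>x i a - b a m\<bar>"
  using off
proof (induction n)
  case 0
  show ?case using m by (intro exI[of _ m]) simp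
next
  case (Suc n)
  then obtain m' where m': "m' \<le> p0" "\<bar>x (i + n) a - b a m'\<bar> \<le> Lam ^ n * \<bar>x i a - b a m\<bar>"
    by auto
  have "x (i + n) a \<in> {0..1} - Pt a" using Suc.prems x_unit[OF a] by auto
  then obtain m'' where m'': "m'' \<le> p0" "\<bar>x (i + Suc n) a - b a m''\<bar> \<le> Lam * \<bar>x (i + n) a - b a m'\<bar>"
    using T_near_partition_step[OF a _ m'(1)] by (auto simp: x_Suc)
  have "Lam * \<bar>x (i + n) a - b a m'\<bar> \<le> Lam * (Lam ^ n * \<bar>x i a - b a m\<bar>)"
    using m'(2) Lam_pos by (intro mult_left_mono) auto
  with m'' show ?case by (intro exI[of _ m'']) (simp add: mult.assoc)
qed

section \<open>The parameter partitions: existence, disjointness and nesting\<close>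

lemma admissible_Union:
  assumes "A \<noteq> {}" "\<And>\<omega>. \<omega> \<in> A \<Longrightarrow> admissible_interval I T p b \<mu> X j \<omega> \<and> c \<in> \<omega>"
  shows "admissible_interval I T p b \<mu> X j (\<Union>A)"
proof -
  have "connected (\<Union>A)"
    using assms(2) by (intro connected_Union) (auto simp: admissible_interval_def is_interval_connected_1)
  then have "is_interval (\<Union>A)" by (simp add: is_interval_connected_1)
  moreover have "\<Union>A \<noteq> {}" using assms by blast
  moreover have "open (\<Union>A)" "\<Union>A \<subseteq> interior I"
    using assms(2) unfolding admissible_interval_def by blast+
  moreover have "\<forall>a\<in>\<Union>A. \<forall>i<j. x i a \<in> supp (\<mu> a) - Pt a"
    using assms(2) unfolding admissible_interval_def by blast
  ultimately show ?thesis unfolding admissible_interval_def by blast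
qed

text \<open>The union of all admissible intervals through one point is again admissible and hence
  maximal, so no choice principle is involved.\<close>

lemma admissible_subset_P:
  assumes "admissible_interval I T p b \<mu> X j \<omega>"
  obtains \<omega>' where "\<omega>' \<in> P j" "\<omega> \<subseteq> \<omega>'"
proof -
  obtain c where c: "c \<in> \<omega>" using assms by (auto simp: admissible_interval_def)
  define A where "A = {\<omega>'. admissible_interval I T p b \<mu> X j \<omega>' \<and> c \<in> \<omega>'}"
  have A: "\<omega> \<in> A" using assms c by (simp add: A_def)
  then have adm: "admissible_interval I T p b \<mu> X j (\<Union>A)"
    by (intro admissible_Union[of A j c]) (auto simp: A_def)
  have "\<Union>A \<in> P j"
    unfolding parameter_partition_def using adm A c by (auto simp: A_def)
  then show ?thesis using that A by blast
qed

lemma P_memD: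
  assumes "\<omega> \<in> P j"
  shows "admissible_interval I T p b \<mu> X j \<omega>" "open \<omega>" "is_interval \<omega>" "\<omega> \<noteq> {}"
    and "\<omega> \<subseteq> interior I" "\<omega> \<subseteq> I"
    and "\<And>a i. a \<in> \<omega> \<Longrightarrow> i < j \<Longrightarrow> x i a \<in> supp (\<mu> a)"
    and "\<And>a i. a \<in> \<omega> \<Longrightarrow> i < j \<Longrightarrow> x i a \<in> {0..1} - Pt a"
proof -
  show adm: "admissible_interval I T p b \<mu> X j \<omega>"
    using assms by (simp add: parameter_partition_def)
  then show "open \<omega>" "is_interval \<omega>" "\<omega> \<noteq> {}" "\<omega> \<subseteq> interior I"
    and "\<And>a i. a \<in> \<omega> \<Longrightarrow> i < j \<Longrightarrow> x i a \<in> supp (\<mu> a)"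
    by (auto simp: admissible_interval_def)
  then show sub: "\<omega> \<subseteq> I" using interior_subset by blast
  show "x i a \<in> {0..1} - Pt a" if "a \<in> \<omega>" "i < j" for a i
    using adm that x_unit[of a i] sub by (auto simp: admissible_interval_def)
qed

lemma admissible_P_overlap:
  assumes "\<omega> \<in> P j" "admissible_interval I T p b \<mu> X j \<omega>'" "\<omega> \<inter> \<omega>' \<noteq> {}"
  shows "\<omega>' \<subseteq> \<omega>"
proof -
  obtain c where "c \<in> \<omega>" "c \<in> \<omega>'" using assms(3) by blast
  then have "admissible_interval I T p b \<mu> X j (\<Union>{\<omega>, \<omega>'})"
    using assms(2) P_memD(1)[OF assms(1)] by (intro admissible_Union[of _ j c]) auto
  then have "\<omega> \<union> \<omega>' = \<omega>" using assms(1) by (auto simp: parameter_partition_def)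
  then show ?thesis by blast
qed

lemma P_disjoint: "\<omega> \<in> P j \<Longrightarrow> \<omega>' \<in> P j \<Longrightarrow> \<omega> \<inter> \<omega>' \<noteq> {} \<Longrightarrow> \<omega> = \<omega>'"
  using admissible_P_overlap P_memD(1) by (metis inf_commute subset_antisym)

lemma countable_P: "countable (P j)"
proof (rule countable_disjoint_open_subsets)
  show "pairwise disjnt (P j)" unfolding pairwise_def disjnt_def using P_disjoint by metis
qed (rule P_memD(2))

lemma P_refines:
  assumes "\<omega> \<in> P j" "i \<le> j"
  obtains \<omega>' where "\<omega>' \<in> P i" "\<omega> \<subseteq> \<omega>'"
proof -
  have "admissible_interval I T p b \<mu> X i \<omega>"
    using P_memD(1)[OF assms(1)] assms(2) by (auto simp: admissible_interval_def)
  then show ?thesis using admissible_subset_P that by blast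
qed

lemma x_differentiable_P:
  assumes "\<omega> \<in> P j" "a \<in> \<omega>" "i \<le> j"
  shows "x i field_differentiable at a"
proof (rule x_differentiable)
  show "a \<in> interior I" using P_memD(5)[OF assms(1)] assms(2) by blast
  show "x l a \<notin> Pt a" if "l < i" for l using P_memD(8)[OF assms(1,2), of l] assms(3) that by simp
qed

section \<open>Growth of derivatives and bounded distortion on parameter intervals\<close>

abbreviation T_deriv :: "nat \<Rightarrow> real \<Rightarrow> real" where
  "T_deriv i a \<equiv> deriv (T a) (x i a)"

text \<open>Condition (I) is applied at level \<open>i\<close>, on the coarser interval that
  contains \<open>a\<close>, with the space derivative expanded by the chain rule. The case
  \<open>i = 0\<close> is excluded because condition (I) starts at level 1.\<close>

lemma deriv_x_comparison:
  assumes "\<omega> \<in> P j" "a \<in> \<omega>" "i \<in> {1..j}"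
  shows "(\<Prod>l<i. \<bar>T_deriv l a\<bar>) / C0 \<le> \<bar>deriv (x i) a\<bar>"
    and "\<bar>deriv (x i) a\<bar> \<le> C0 * (\<Prod>l<i. \<bar>T_deriv l a\<bar>)"
proof -
  obtain \<omega>' where \<omega>': "\<omega>' \<in> P i" "a \<in> \<omega>'"
    using P_refines[OF assms(1), of i] assms(2,3) by (metis atLeastAtMost_iff subsetD)
  note off = P_memD(8)[OF \<omega>'(1,2)]
  have aI: "a \<in> I" using P_memD(6)[OF \<omega>'(1)] \<omega>'(2) by blast
  have "deriv (T a ^^ i) (X a) = (\<Prod>l<i. T_deriv l a)"
    using deriv_funpow_T[OF aI] off by (intro DERIV_imp_deriv) auto
  moreover have "lam \<le> \<bar>T_deriv l a\<bar>" if "l < i" for l using deriv_T_bounds(1)[OF aI] off that by blast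
  then have "(\<Prod>l<i. \<bar>T_deriv l a\<bar>) > 0" using lam_pos by (intro prod_pos) force
  moreover have "C0 > 0" using C0_ge_1 by simp
  ultimately show "(\<Prod>l<i. \<bar>T_deriv l a\<bar>) / C0 \<le> \<bar>deriv (x i) a\<bar>"
    and "\<bar>deriv (x i) a\<bar> \<le> C0 * (\<Prod>l<i. \<bar>T_deriv l a\<bar>)"
    using derivative_ratio[OF _ \<omega>'] assms(3) by (auto simp: abs_prod field_simps)
qed

lemma power_le_prod_T_deriv:
  assumes "\<omega> \<in> P j" "a \<in> \<omega>" "i \<le> j"
  shows "lam ^ (j - i) * (\<Prod>l<i. \<bar>T_deriv l a\<bar>) \<le> (\<Prod>l<j. \<bar>T_deriv l a\<bar>)"
proof -
  have lam_le: "lam \<le> \<bar>T_deriv l a\<bar>" if "l < j" for l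
    using deriv_T_bounds(1) P_memD(6,8)[OF assms(1)] assms(2) that by blast
  have "(\<Prod>l<j. \<bar>T_deriv l a\<bar>) = (\<Prod>l<i. \<bar>T_deriv l a\<bar>) * (\<Prod>l=i..<j. \<bar>T_deriv l a\<bar>)"
    using assms(3) by (metis prod.atLeastLessThan_concat lessThan_atLeast0 zero_le)
  moreover have "(\<Prod>l=i..<j. lam) \<le> (\<Prod>l=i..<j. \<bar>T_deriv l a\<bar>)"
    using lam_pos lam_le by (intro prod_mono) auto
  then have "lam ^ (j - i) \<le> (\<Prod>l=i..<j. \<bar>T_deriv l a\<bar>)" by simp
  ultimately show ?thesis
    by (subst mult.commute) (simp add: mult_left_mono prod_nonneg)
qed

lemma deriv_x_lower:
  assumes "\<omega> \<in> P j" "a \<in> \<omega>" "1 \<le> j"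
  shows "lam ^ j / C0 \<le> \<bar>deriv (x j) a\<bar>" "deriv (x j) a \<noteq> 0"
proof -
  have "lam ^ j / C0 \<le> (\<Prod>l<j. \<bar>T_deriv l a\<bar>) / C0"
    using power_le_prod_T_deriv[OF assms(1,2), of 0] C0_ge_1 by (intro divide_right_mono) auto
  then show le: "lam ^ j / C0 \<le> \<bar>deriv (x j) a\<bar>"
    using deriv_x_comparison(1)[OF assms(1,2), of j] assms(3) by simp
  have "0 < lam ^ j / C0" using lam_pos C0_ge_1 by simp
  then show "deriv (x j) a \<noteq> 0" using le by auto
qed

text \<open>Each of the \<open>j - i\<close> derivative factors gained between the two times is at
  least \<open>lam\<close>. One \<open>C0\<close> comes from condition (I) at time \<open>i\<close>,
  the other from time \<open>j\<close>.\<close>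

lemma deriv_x_growth:
  assumes "\<omega> \<in> P j" "a \<in> \<omega>" "i \<in> {1..j}"
  shows "\<bar>deriv (x i) a\<bar> \<le> C0\<^sup>2 / lam ^ (j - i) * \<bar>deriv (x j) a\<bar>"
proof -
  have C0: "C0 > 0" using C0_ge_1 by simp
  have "\<bar>deriv (x i) a\<bar> \<le> C0 * (\<Prod>l<i. \<bar>T_deriv l a\<bar>)" by (rule deriv_x_comparison(2)[OF assms])
  also have "\<dots> = C0 / lam ^ (j - i) * (lam ^ (j - i) * (\<Prod>l<i. \<bar>T_deriv l a\<bar>))"
    using lam_pos by simp
  also have "\<dots> \<le> C0 / lam ^ (j - i) * (\<Prod>l<j. \<bar>T_deriv l a\<bar>)"
    using power_le_prod_T_deriv[OF assms(1,2)] assms(3) C0 lam_pos by (intro mult_left_mono) auto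
  also have "\<dots> \<le> C0 / lam ^ (j - i) * (C0 * \<bar>deriv (x j) a\<bar>)"
    using deriv_x_comparison(1)[OF assms(1,2), of j] assms(3) C0 lam_pos
    by (intro mult_left_mono) (auto simp: field_simps)
  finally show ?thesis by (simp add: power2_eq_square)
qed

lemma x_increment_growth:
  assumes "\<omega> \<in> P j" "a \<in> \<omega>" "a' \<in> \<omega>" "i \<in> {1..j}"
  shows "\<bar>x i a' - x i a\<bar> \<le> C0\<^sup>2 / lam ^ (j - i) * \<bar>x j a' - x j a\<bar>"
    and "\<bar>a' - a\<bar> \<le> C0 / lam ^ j * \<bar>x j a' - x j a\<bar>"
proof -
  have j: "1 \<le> j" using assms(4) by simp
  note mvt = Cauchy_mvt_bound[OF P_memD(3)[OF assms(1)] assms(2,3), where g = "x j"]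
  show "\<bar>x i a' - x i a\<bar> \<le> C0\<^sup>2 / lam ^ (j - i) * \<bar>x j a' - x j a\<bar>"
    using assms(4) j
    by (intro mvt x_differentiable_P[OF assms(1)] deriv_x_growth[OF assms(1)]
        deriv_x_lower(2)[OF assms(1)]) auto
  show "\<bar>a' - a\<bar> \<le> C0 / lam ^ j * \<bar>x j a' - x j a\<bar>"
  proof (rule mvt)
    show "\<bar>deriv (\<lambda>a. a) c\<bar> \<le> C0 / lam ^ j * \<bar>deriv (x j) c\<bar>" if "c \<in> \<omega>" for c
      using deriv_x_lower(1)[OF assms(1) that j] lam_pos C0_ge_1 by (simp add: field_simps)
    show "deriv (x j) c \<noteq> 0" if "c \<in> \<omega>" for c
      using deriv_x_lower(2)[OF assms(1) that j] .
    show "x j field_differentiable at c" if "c \<in> \<omega>" for c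
      using x_differentiable_P[OF assms(1) that] by simp
  qed simp
qed

text \<open>The image under \<open>x j\<close> stays in the unit interval, so going backwards in
  time everything is exponentially small.\<close>

lemma P_small:
  assumes "\<omega> \<in> P j" "a \<in> \<omega>" "a' \<in> \<omega>" "i \<in> {1..j}"
  shows "\<bar>x i a' - x i a\<bar> \<le> C0\<^sup>2 / lam ^ (j - i)" and "\<bar>a' - a\<bar> \<le> C0 / lam ^ j"
proof -
  have "x j a \<in> {0..1}" "x j a' \<in> {0..1}" using x_unit P_memD(6)[OF assms(1)] assms by auto
  then have le: "\<bar>x j a' - x j a\<bar> \<le> 1" by auto
  have "C0\<^sup>2 / lam ^ (j - i) * \<bar>x j a' - x j a\<bar> \<le> C0\<^sup>2 / lam ^ (j - i) * 1"
    using le lam_pos by (intro mult_left_mono) auto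
  then show "\<bar>x i a' - x i a\<bar> \<le> C0\<^sup>2 / lam ^ (j - i)" using x_increment_growth(1)[OF assms] by simp
  have "C0 / lam ^ j * \<bar>x j a' - x j a\<bar> \<le> C0 / lam ^ j * 1"
    using le lam_pos C0_ge_1 by (intro mult_left_mono) auto
  then show "\<bar>a' - a\<bar> \<le> C0 / lam ^ j" using x_increment_growth(2)[OF assms] by simp
qed

text \<open>The curve \<open>a \<mapsto> (a, x i a)\<close> need not stay in one rectangle, so
  \<open>deriv_T_box\<close> is used locally and the estimates are added up. They add up without
  loss because \<open>x i\<close> is monotone on the interval.\<close>

lemma T_deriv_increment:
  assumes \<omega>: "\<omega> \<in> P j" and a: "a \<in> \<omega>" "a' \<in> \<omega>" and i: "1 \<le> i" "i < j"
  shows "\<bar>T_deriv i a' - T_deriv i a\<bar> \<le> L * \<bar>a' - a\<bar> + L * \<bar>x i a' - x i a\<bar>"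
proof -
  have "strict_mono_on \<omega> (x i) \<or> strict_antimono_on \<omega> (x i)"
  proof (rule nonzero_deriv_imp_monotone[OF P_memD(3)[OF \<omega>]])
    fix c assume c: "c \<in> \<omega>"
    show "x i field_differentiable at c" using x_differentiable_P[OF \<omega> c] i by simp
    obtain \<omega>' where "\<omega>' \<in> P i" "\<omega> \<subseteq> \<omega>'" using P_refines[OF \<omega>, of i] i by auto
    then show "deriv (x i) c \<noteq> 0" using deriv_x_lower(2) c i(1) by blast
  qed
  then obtain \<sigma> :: real where \<sigma>: "\<And>s t. s \<in> \<omega> \<Longrightarrow> t \<in> \<omega> \<Longrightarrow> s \<le> t \<Longrightarrow> \<bar>x i t - x i s\<bar> = \<sigma> * x i t - \<sigma> * x i s"
  proof
    assume "strict_mono_on \<omega> (x i)"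
    then show ?thesis using that[of 1] by (force dest!: strict_mono_on_imp_mono_on dest: monotone_onD)
  next
    assume *: "strict_antimono_on \<omega> (x i)"
    have "x i t \<le> x i s" if "s \<in> \<omega>" "t \<in> \<omega>" "s \<le> t" for s t
      using monotone_onD[OF * that(1,2)] that(3) by (cases "s = t") auto
    then show ?thesis using that[of "-1"] by force
  qed
  have main: "\<bar>T_deriv i a' - T_deriv i a\<bar> \<le> L * \<bar>a' - a\<bar> + L * \<bar>x i a' - x i a\<bar>"
    if a: "a \<in> \<omega>" "a' \<in> \<omega>" and le: "a \<le> a'" for a a'
  proof -
    \<comment> \<open>The sign \<open>\<sigma>\<close> of the monotonicity turns the absolute
      increments of \<open>x i\<close> into differences, which gives the additive form that
      \<open>increment_bound_if_locally\<close> requires.\<close>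
    define h where "h s = L * s + L * (\<sigma> * x i s)" for s
    have seg: "s \<in> \<omega>" if "a \<le> s" "s \<le> a'" for s
      using P_memD(3)[OF \<omega>] a that by (rule mem_is_interval_1_I)
    have "\<bar>T_deriv i a' - T_deriv i a\<bar> \<le> h a' - h a"
      using le
    proof (rule increment_bound_if_locally)
      fix c assume "a \<le> c" "c \<le> a'"
      then have c: "c \<in> \<omega>" by (rule seg)
      then have cI: "c \<in> interior I" "c \<in> I" using P_memD(5,6)[OF \<omega>] by auto
      obtain k where "k \<in> {1..p0}" "x i c \<in> Br c k"
        using branch_exists[OF cI(2) P_memD(8)[OF \<omega> c i(2)]] .
      then obtain r where r: "box c k (x i c) r" using box_exists[OF cI(1)] by blast
      have "isCont (x i) c"
        using x_differentiable_P[OF \<omega> c] i by (simp add: field_differentiable_imp_continuous_at)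
      then obtain e0 where e0: "e0 > 0" "\<And>s. dist s c < e0 \<Longrightarrow> dist (x i s) (x i c) < r"
        using boxD(1)[OF r] unfolding continuous_at_eps_delta by (auto simp: dist_real_def)
      show "\<exists>e>0. \<forall>s t. \<bar>s - c\<bar> < e \<and> \<bar>t - c\<bar> < e \<and> a \<le> s \<and> s \<le> t \<and> t \<le> a' \<longrightarrow>
          \<bar>T_deriv i t - T_deriv i s\<bar> \<le> h t - h s"
      proof (intro exI[of _ "min e0 r"] conjI allI impI)
        show "min e0 r > 0" using e0 boxD(1)[OF r] by simp
        fix s t assume st: "\<bar>s - c\<bar> < min e0 r \<and> \<bar>t - c\<bar> < min e0 r \<and> a \<le> s \<and> s \<le> t \<and> t \<le> a'"
        then have "s \<in> \<omega>" "t \<in> \<omega>" by (auto intro: seg)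
        then have eq: "\<bar>x i t - x i s\<bar> = \<sigma> * x i t - \<sigma> * x i s" using \<sigma> st by blast
        have "\<bar>T_deriv i t - T_deriv i s\<bar> \<le> L * \<bar>t - s\<bar> + L * \<bar>x i t - x i s\<bar>"
          using st e0(2)[of s] e0(2)[of t]
          by (intro deriv_T_box[OF r]) (auto simp: dist_real_def abs_minus_commute)
        then show "\<bar>T_deriv i t - T_deriv i s\<bar> \<le> h t - h s"
          using st eq by (simp add: h_def algebra_simps)
      qed
    qed
    also have "h a' - h a = L * \<bar>a' - a\<bar> + L * \<bar>x i a' - x i a\<bar>"
      unfolding \<sigma>[OF a le] using le by (simp add: h_def algebra_simps)
    finally show ?thesis .
  qed
  show ?thesis
    using main[of a a'] main[of a' a] a by (cases "a \<le> a'") (auto simp: abs_minus_commute)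
qed

text \<open>\<open>C0\<^sup>2\<close> pays for replacing the parameter derivatives at two points by
  derivative products, \<open>Lam\<close> for the factor at time 0, and the exponential for the
  geometrically summable variation of all later factors.\<close>

definition distortion :: real where
  "distortion = C0\<^sup>2 * Lam * exp (2 * L * C0\<^sup>2 / (lam - 1))"

lemma distortion_bound:
  assumes \<omega>: "\<omega> \<in> P j" and a: "a \<in> \<omega>" "a' \<in> \<omega>" and j: "1 \<le> j"
  shows "\<bar>deriv (x j) a\<bar> \<le> distortion * \<bar>deriv (x j) a'\<bar>"
proof -
  define \<Delta> where "\<Delta> i = 2 * L * C0\<^sup>2 / lam ^ (j - i)" for i
  have C0: "C0 > 0" using C0_ge_1 by simp
  have one_le: "1 \<le> \<bar>T_deriv i c\<bar>" and le_Lam: "\<bar>T_deriv i c\<bar> \<le> Lam" if "i < j" "c \<in> \<omega>" for i c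
    using deriv_T_bounds[OF _ P_memD(8)[OF \<omega> that(2,1)]] P_memD(6)[OF \<omega>] that constants by auto
  \<comment> \<open>At time 0 neither \<open>P_small\<close> nor \<open>T_deriv_increment\<close> is
    available, so the ratio is bounded by \<open>Lam\<close>, both derivatives lying between 1 and
    \<open>Lam\<close> in modulus.\<close>
  have factor: "\<bar>T_deriv i a\<bar> \<le> (if i = 0 then Lam else 1) * (exp (\<Delta> i) * \<bar>T_deriv i a'\<bar>)" if "i < j" for i
  proof (cases "i = 0")
    case True
    have "1 \<le> exp (\<Delta> i) * \<bar>T_deriv i a'\<bar>"
      using mult_mono[of 1 "exp (\<Delta> i)" 1 "\<bar>T_deriv i a'\<bar>"] one_le[OF that a(2)] constants lam_pos
      by (simp add: \<Delta>_def)
    then have "Lam * 1 \<le> Lam * (exp (\<Delta> i) * \<bar>T_deriv i a'\<bar>)" using Lam_pos by (intro mult_left_mono) auto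
    then show ?thesis using True le_Lam[OF that a(1)] by simp
  next
    case False
    have "\<bar>T_deriv i a - T_deriv i a'\<bar> \<le> L * \<bar>a - a'\<bar> + L * \<bar>x i a - x i a'\<bar>"
      using T_deriv_increment[OF \<omega> a(2,1)] False that by simp
    also have "\<dots> \<le> L * (C0\<^sup>2 / lam ^ (j - i)) + L * (C0\<^sup>2 / lam ^ (j - i))"
    proof (intro add_mono mult_left_mono)
      have "\<bar>a - a'\<bar> \<le> C0 / lam ^ j" using P_small(2)[OF \<omega> a(2,1), of i] False that by simp
      also have "\<dots> \<le> C0\<^sup>2 / lam ^ (j - i)"
        using C0_ge_1 constants lam_pos
        by (intro frac_le power_increasing) (auto simp: power2_eq_square)
      finally show "\<bar>a - a'\<bar> \<le> C0\<^sup>2 / lam ^ (j - i)" .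
      show "\<bar>x i a - x i a'\<bar> \<le> C0\<^sup>2 / lam ^ (j - i)"
        using P_small(1)[OF \<omega> a(2,1), of i] False that by simp
    qed (use constants in auto)
    also have "\<dots> = \<Delta> i" by (simp add: \<Delta>_def)
    \<comment> \<open>Expansion makes the derivative at least 1 in modulus, which turns the additive
      error into a multiplicative one.\<close>
    also have "\<Delta> i \<le> \<Delta> i * \<bar>T_deriv i a'\<bar>"
      using mult_left_mono[OF one_le[OF that a(2)], of "\<Delta> i"] constants lam_pos by (simp add: \<Delta>_def)
    finally have "\<bar>T_deriv i a\<bar> \<le> (1 + \<Delta> i) * \<bar>T_deriv i a'\<bar>" by (simp add: algebra_simps)
    also have "\<dots> \<le> exp (\<Delta> i) * \<bar>T_deriv i a'\<bar>" by (intro mult_right_mono exp_ge_add_one_self) simp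
    finally show ?thesis using False by simp
  qed
  have "(\<Prod>i<j. \<bar>T_deriv i a\<bar>) \<le> (\<Prod>i<j. (if i = 0 then Lam else 1) * (exp (\<Delta> i) * \<bar>T_deriv i a'\<bar>))"
    using factor by (intro prod_mono) auto
  also have "\<dots> = Lam * exp (\<Sum>i<j. \<Delta> i) * (\<Prod>i<j. \<bar>T_deriv i a'\<bar>)"
    using j by (simp add: prod.distrib exp_sum prod.delta)
  also have "\<dots> \<le> Lam * exp (2 * L * C0\<^sup>2 / (lam - 1)) * (\<Prod>i<j. \<bar>T_deriv i a'\<bar>)"
  proof -
    have "(\<Sum>i<j. \<Delta> i) = 2 * L * C0\<^sup>2 * (\<Sum>i<j. 1 / lam ^ (j - i))"
      by (simp add: \<Delta>_def sum_distrib_left)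
    also have "\<dots> \<le> 2 * L * C0\<^sup>2 * (1 / (lam - 1))"
      using constants sum_inverse_power_le[of lam j] by (intro mult_left_mono) auto
    finally show ?thesis using Lam_pos
      by (intro mult_right_mono mult_left_mono) (auto intro!: prod_nonneg)
  qed
  finally have le: "(\<Prod>i<j. \<bar>T_deriv i a\<bar>) \<le> Lam * exp (2 * L * C0\<^sup>2 / (lam - 1)) * (\<Prod>i<j. \<bar>T_deriv i a'\<bar>)" .
  have "\<bar>deriv (x j) a\<bar> \<le> C0 * (\<Prod>i<j. \<bar>T_deriv i a\<bar>)"
    using deriv_x_comparison(2)[OF \<omega> a(1), of j] j by simp
  also have "\<dots> \<le> C0 * (Lam * exp (2 * L * C0\<^sup>2 / (lam - 1)) * (\<Prod>i<j. \<bar>T_deriv i a'\<bar>))"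
    using le C0 by (intro mult_left_mono) auto
  also have "\<dots> \<le> C0 * (Lam * exp (2 * L * C0\<^sup>2 / (lam - 1)) * (C0 * \<bar>deriv (x j) a'\<bar>))"
    using deriv_x_comparison(1)[OF \<omega> a(2), of j] j C0 Lam_pos
    by (intro mult_left_mono) (auto simp: field_simps)
  finally show ?thesis by (simp add: distortion_def power2_eq_square mult_ac)
qed

end

section \<open>Images of parameter intervals\<close>

lemma closed_supp:
  assumes "sets \<nu> = sets unit_borel"
  shows "closed (supp \<nu>)"
proof -
  have space: "space \<nu> = {0..1}"
    using sets_eq_imp_space_eq[OF assms] by (simp add: space_restrict_space)
  define N where "N = \<Union>{U. open U \<and> \<not> emeasure \<nu> (U \<inter> space \<nu>) > 0}"
  have "supp \<nu> = {0..1} - N"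
    unfolding supp_def N_def space by blast
  moreover have "open N" unfolding N_def by blast
  ultimately show ?thesis by (simp add: closed_Diff)
qed

lemma eventually_less_if_tendsto:
  fixes f g :: "'a \<Rightarrow> real"
  assumes "u < v" "(f \<longlongrightarrow> u) F" "(g \<longlongrightarrow> v) F"
  shows "\<forall>\<^sub>F z in F. f z < g z"
proof -
  obtain w where "u < w" "w < v" using dense assms(1) by blast
  then have "\<forall>\<^sub>F z in F. f z < w" "\<forall>\<^sub>F z in F. w < g z"
    using order_tendstoD assms(2,3) by blast+
  then show ?thesis by eventually_elim simp
qed

context markov_family
begin

lemma sets_\<mu>: "a \<in> I \<Longrightarrow> sets (\<mu> a) = sets unit_borel"
  using unique_acip unfolding acip_def by metis

lemma supp_subset_unit: "a \<in> I \<Longrightarrow> supp (\<mu> a) \<subseteq> {0..1}"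
  using sets_eq_imp_space_eq[OF sets_\<mu>] by (auto simp: supp_def space_restrict_space)

text \<open>Property (iii) controls the support only through the ends of its components. A point
  outside the closed support at \<open>c\<close> is strictly separated from each of the finitely
  many components, and continuity of their ends preserves this for nearby parameters. But on
  \<open>\<omega>\<close> the point lies in some component.\<close>

lemma x_mem_supp_limit:
  assumes c: "c \<in> I" and \<omega>: "\<omega> \<in> P j" "c \<in> closure \<omega>" and i: "i < j" and cont: "isCont (x i) c"
  shows "x i c \<in> supp (\<mu> c)"
proof (rule ccontr)
  assume out: "x i c \<notin> supp (\<mu> c)"
  then have "c \<notin> \<omega>" using P_memD(7)[OF \<omega>(1) _ i] by blast
  then have nontriv: "at c within \<omega> \<noteq> bot"
    using \<omega>(2) by (simp add: trivial_limit_within closure_def)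
  obtain p1 and D :: "nat \<Rightarrow> real \<Rightarrow> real set" where
    D: "\<And>a. a \<in> I \<Longrightarrow> bij_betw (\<lambda>k. D k a) {1..p1} (components (supp (\<mu> a) - Pt a))"
    and Dcont: "\<And>k. k \<in> {1..p1} \<Longrightarrow> continuous_on I (\<lambda>a. Inf (D k a))"
      "\<And>k. k \<in> {1..p1} \<Longrightarrow> continuous_on I (\<lambda>a. Sup (D k a))"
    using property_iii unfolding property_iii_def by blast
  have xlim: "(x i \<longlongrightarrow> x i c) (at c within \<omega>)"
    using cont unfolding isCont_def by (rule tendsto_within_subset) simp
  have lim: "(f \<longlongrightarrow> f c) (at c within \<omega>)" if "continuous_on I f" for f :: "real \<Rightarrow> real"
    using that c P_memD(6)[OF \<omega>(1)] by (auto simp: continuous_on_def intro: tendsto_within_subset)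
  have inI: "\<forall>\<^sub>F a in at c within \<omega>. a \<in> \<omega>" by (simp add: eventually_at_filter)
  have comp: "D k a \<in> components (supp (\<mu> a) - Pt a)" if "k \<in> {1..p1}" "a \<in> I" for k a
    using D[OF that(2)] that(1) by (auto simp: bij_betw_def)
  have bdd: "bdd_below (D k a)" "bdd_above (D k a)" "D k a \<noteq> {}" "D k a \<subseteq> supp (\<mu> a)" "connected (D k a)"
    if "k \<in> {1..p1}" "a \<in> I" for k a
  proof -
    show "D k a \<subseteq> supp (\<mu> a)" using in_components_subset[OF comp[OF that]] by blast
    then have "D k a \<subseteq> {0..1}" using supp_subset_unit[OF that(2)] by blast
    then show "bdd_below (D k a)" "bdd_above (D k a)"
      by (meson bdd_above_Icc bdd_below_Icc bdd_above_mono bdd_below_mono)+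
    show "D k a \<noteq> {}" "connected (D k a)"
      using in_components_nonempty[OF comp[OF that]] in_components_connected[OF comp[OF that]] by auto
  qed
  have "\<forall>\<^sub>F a in at c within \<omega>. x i a \<notin> D k a" if k: "k \<in> {1..p1}" for k
  proof -
    have "closure (D k c) \<subseteq> supp (\<mu> c)"
      using bdd(4)[OF k c] closed_supp[OF sets_\<mu>[OF c]] by (rule closure_minimal)
    \<comment> \<open>Including the end points is what makes the inequalities for
      \<open>x i c\<close> strict, hence stable under small changes of the parameter.\<close>
    moreover have "{Inf (D k c)..Sup (D k c)} \<subseteq> closure (D k c)"
    proof
      fix z assume z: "z \<in> {Inf (D k c)..Sup (D k c)}"
      have "is_interval (closure (D k c))"
        using bdd(5)[OF k c] by (simp add: is_interval_connected_1 connected_imp_connected_closure)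
      then show "z \<in> closure (D k c)"
        using closure_contains_Inf[OF bdd(3,1)[OF k c]] closure_contains_Sup[OF bdd(3,2)[OF k c]]
        by (rule mem_is_interval_1_I) (use z in simp_all)
    qed
    ultimately have "x i c \<notin> {Inf (D k c)..Sup (D k c)}" using out by blast
    then have "x i c < Inf (D k c) \<or> Sup (D k c) < x i c" by (simp only: atLeastAtMost_iff not_le de_Morgan_conj)
    then show ?thesis
    proof
      assume "x i c < Inf (D k c)"
      then have "\<forall>\<^sub>F a in at c within \<omega>. x i a < Inf (D k a)"
        using xlim lim[OF Dcont(1)[OF k]] by (rule eventually_less_if_tendsto)
      then show ?thesis using inI
        by eventually_elim (use cInf_lower[OF _ bdd(1)[OF k]] P_memD(6)[OF \<omega>(1)] in \<open>meson not_le subsetD\<close>)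
    next
      assume "Sup (D k c) < x i c"
      then have "\<forall>\<^sub>F a in at c within \<omega>. Sup (D k a) < x i a"
        using lim[OF Dcont(2)[OF k]] xlim by (rule eventually_less_if_tendsto)
      then show ?thesis using inI
        by eventually_elim (use cSup_upper[OF _ bdd(2)[OF k]] P_memD(6)[OF \<omega>(1)] in \<open>meson not_le subsetD\<close>)
    qed
  qed
  then have "\<forall>\<^sub>F a in at c within \<omega>. \<forall>k\<in>{1..p1}. x i a \<notin> D k a"
    by (intro eventually_ball_finite) auto
  then have "\<forall>\<^sub>F a in at c within \<omega>. False"
    using inI
  proof eventually_elim
    case (elim a)
    then have "x i a \<in> supp (\<mu> a) - Pt a" "a \<in> I"
      using P_memD(6,7,8)[OF \<omega>(1)] i by auto
    then obtain C where "C \<in> components (supp (\<mu> a) - Pt a)" "x i a \<in> C"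
      using Union_components[of "supp (\<mu> a) - Pt a"] by blast
    then show False using D[OF \<open>a \<in> I\<close>] elim(1) by (auto simp: bij_betw_def)
  qed
  then show False using nontriv by simp
qed

text \<open>An end point at which no \<open>x i\<close>, \<open>i < j\<close>, met the partition would be an isolated exceptional
  parameter. By property (iii) the points \<open>x i c\<close> would lie in the support there as well, so the
  interval could be extended beyond it.\<close>

lemma endpoint_hits_partition:
  assumes c: "c \<in> interior I" and \<omega>: "\<omega> \<in> P j" "c \<in> closure \<omega>" "c \<notin> \<omega>" and j: "1 \<le> j"
  obtains i m where "i < j" "m \<le> p0" "x i c = b c m" "isCont (x i) c"
proof -
  have cI: "c \<in> I" using c interior_subset by blast
  have "\<exists>i<j. x i c \<in> Pt c"
  proof (rule ccontr)
    assume "\<not> ?thesis"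
    then have off: "x i c \<notin> Pt c" if "i < j" for i using that by blast
    have cont: "isCont (x i) c" if "i < j" for i
      using that off by (intro field_differentiable_imp_continuous_at x_differentiable[OF c]) auto
    have "\<exists>e>0. \<forall>a\<in>ball c e. x i a \<notin> Pt a" if ij: "i < j" for i
    proof -
      obtain k where k: "k \<in> {1..p0}" "x i c \<in> Br c k"
        using branch_exists[OF cI, of "x i c"] off[OF ij] x_unit[OF cI] by blast
      obtain r where r: "box c k (x i c) r" using box_exists[OF c k] .
      obtain e where e: "e > 0" "\<And>a. dist a c < e \<Longrightarrow> dist (x i a) (x i c) < r"
        using cont[OF ij] boxD(1)[OF r] unfolding continuous_at_eps_delta by (auto simp: dist_real_def)
      have "x i a \<notin> Pt a" if a: "a \<in> ball c (min e r)" for a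
      proof -
        have "x i a \<in> Br a k" "a \<in> I"
          using a e(2)[of a] boxD(3)[OF r] by (auto intro!: boxD(4)[OF r] simp: dist_commute)
        then show ?thesis using branch_subset boxD(2)[OF r] by blast
      qed
      then show ?thesis using e(1) boxD(1)[OF r] by (intro exI[of _ "min e r"]) auto
    qed
    then obtain e where e: "\<And>i. i < j \<Longrightarrow> e i > 0 \<and> (\<forall>a\<in>ball c (e i). x i a \<notin> Pt a)" by metis
    \<comment> \<open>A finite set of exceptions keeps away from \<open>c\<close> once
      \<open>c\<close> itself is removed. So every other parameter near \<open>c\<close> lies in
      some element of level \<open>j\<close>, which supplies membership in the support; for
      \<open>c\<close> this is \<open>x_mem_supp_limit\<close>.\<close>
    have "finite (I - \<Union>(P j) - {c})" using finite_exceptions[OF j] by simp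
    then have "closed (I - \<Union>(P j) - {c})" by (rule finite_imp_closed)
    then have "open (interior I - (I - \<Union>(P j) - {c}))" by (intro open_Diff open_interior)
    moreover have "c \<in> interior I - (I - \<Union>(P j) - {c})" using c by simp
    ultimately obtain e0 where e0: "e0 > 0" "ball c e0 \<subseteq> interior I - (I - \<Union>(P j) - {c})"
      by (rule openE)
    define r where "r = Min (insert e0 (e ` {..<j}))"
    have r: "r > 0" "r \<le> e0" "\<And>i. i < j \<Longrightarrow> r \<le> e i"
      using e e0(1) by (auto simp: r_def)
    have "admissible_interval I T p b \<mu> X j (ball c r)"
      unfolding admissible_interval_def
    proof (intro conjI ballI allI impI)
      show "is_interval (ball c r)" by (rule is_interval_ball_real)
      show "ball c r \<noteq> {}" using r by simp
      show "ball c r \<subseteq> interior I" using e0(2) subset_ball[OF r(2), of c] by blast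
      fix a i assume a: "a \<in> ball c r" and i: "i < j"
      have "a \<in> ball c (e i)" using a r(3)[OF i] by auto
      then have "x i a \<notin> Pt a" using e[OF i] by blast
      moreover have "x i a \<in> supp (\<mu> a)"
      proof (cases "a = c")
        case True
        then show ?thesis using x_mem_supp_limit[OF cI \<omega>(1,2) i cont[OF i]] by simp
      next
        case False
        have "a \<in> ball c e0" using a r(2) by auto
        then have "a \<in> \<Union>(P j)" using e0(2) False interior_subset by blast
        then show ?thesis using P_memD(7) i by blast
      qed
      ultimately show "x i a \<in> supp (\<mu> a) - Pt a" by simp
    qed simp
    moreover have "\<omega> \<inter> ball c r \<noteq> {}"
    proof -
      have "c \<in> ball c r \<inter> closure \<omega>" using \<omega>(2) r(1) by simp
      then show ?thesis using open_Int_closure_eq_empty[OF open_ball, of c r \<omega>] by blast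
    qed
    ultimately have "ball c r \<subseteq> \<omega>" using admissible_P_overlap[OF \<omega>(1)] by blast
    then show False using \<omega>(3) centre_in_ball[of c r] r(1) by blast
  qed
  \<comment> \<open>The first such time is taken: before it the orbit avoids the partition, so
    \<open>x i\<close> is still continuous at \<open>c\<close>.\<close>
  then obtain i where i: "i < j" "x i c \<in> Pt c" "\<And>l. l < i \<Longrightarrow> x l c \<notin> Pt c"
    using exists_least_iff[of "\<lambda>i. i < j \<and> x i c \<in> Pt c"] by (metis less_trans)
  then obtain m where "m \<le> p0" "x i c = b c m" using Pt_eq[OF cI] by auto
  moreover have "isCont (x i) c"
    using i(3) by (intro field_differentiable_imp_continuous_at x_differentiable[OF c]) auto
  ultimately show ?thesis using that i(1) by blast
qed

text \<open>Just inside \<open>\<omega>\<close>, \<open>x i\<close> is close to the curve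
  \<open>b a m\<close> that it meets at \<open>c\<close>, and the remaining \<open>j - i\<close>
  steps enlarge the distance to the partition by at most the fixed factor
  \<open>Lam ^ (j - i)\<close>. The parameter is taken inside \<open>\<omega>\<close> because
  \<open>x j\<close> may jump at \<open>c\<close>.\<close>

lemma x_near_partition_at_endpoint:
  assumes c: "c \<in> interior I" and \<omega>: "\<omega> \<in> P j" "c \<in> closure \<omega>" "c \<notin> \<omega>" and j: "1 \<le> j" and "0 < \<epsilon>"
  obtains a m where "a \<in> \<omega>" "\<bar>a - c\<bar> < \<epsilon>" "m \<le> p0" "\<bar>x j a - b a m\<bar> < \<epsilon>"
proof -
  obtain i m where i: "i < j" and m: "m \<le> p0" "x i c = b c m" and cont: "isCont (x i) c"
    using endpoint_hits_partition[OF c \<omega> j] .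
  have cI: "c \<in> I" using c interior_subset by blast
  have nontriv: "at c within \<omega> \<noteq> bot"
    using \<omega>(2,3) by (simp add: trivial_limit_within closure_def)
  have "continuous_on I (\<lambda>a. b a m)" using b_lipschitz[OF m(1)] by (rule lipschitz_on_continuous_on)
  then have "((\<lambda>a. b a m) \<longlongrightarrow> b c m) (at c within \<omega>)"
    using cI P_memD(6)[OF \<omega>(1)] by (auto simp: continuous_on_def intro: tendsto_within_subset)
  moreover have "(x i \<longlongrightarrow> x i c) (at c within \<omega>)"
    using cont unfolding isCont_def by (rule tendsto_within_subset) simp
  ultimately have "((\<lambda>a. Lam ^ (j - i) * \<bar>x i a - b a m\<bar>) \<longlongrightarrow> Lam ^ (j - i) * \<bar>x i c - b c m\<bar>) (at c within \<omega>)"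
    by (intro tendsto_intros)
  then have "((\<lambda>a. Lam ^ (j - i) * \<bar>x i a - b a m\<bar>) \<longlongrightarrow> 0) (at c within \<omega>)" using m(2) by simp
  then have "\<forall>\<^sub>F a in at c within \<omega>. Lam ^ (j - i) * \<bar>x i a - b a m\<bar> < \<epsilon>"
    using \<open>0 < \<epsilon>\<close> by (rule order_tendstoD)
  moreover have "\<forall>\<^sub>F a in at c within \<omega>. a \<in> \<omega>" by (simp add: eventually_at_filter)
  moreover have "\<forall>\<^sub>F a in at c within \<omega>. \<bar>a - c\<bar> < \<epsilon>"
    using \<open>0 < \<epsilon>\<close> unfolding eventually_at by (auto simp: dist_real_def)
  ultimately have "\<forall>\<^sub>F a in at c within \<omega>. a \<in> \<omega> \<and> \<bar>a - c\<bar> < \<epsilon> \<and> Lam ^ (j - i) * \<bar>x i a - b a m\<bar> < \<epsilon>"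
    by eventually_elim simp
  then obtain a where a: "a \<in> \<omega>" "\<bar>a - c\<bar> < \<epsilon>" "Lam ^ (j - i) * \<bar>x i a - b a m\<bar> < \<epsilon>"
    using nontriv eventually_happens' by blast
  have "x l a \<notin> Pt a" if "l < i + (j - i)" for l using P_memD(8)[OF \<omega>(1) a(1), of l] that i by simp
  then obtain m' where "m' \<le> p0" "\<bar>x (i + (j - i)) a - b a m'\<bar> \<le> Lam ^ (j - i) * \<bar>x i a - b a m\<bar>"
    using x_near_partition[OF _ m(1), of a i "j - i"] P_memD(6)[OF \<omega>(1)] a(1) by blast
  then show ?thesis using that[of a m'] a i by simp
qed

section \<open>Definite size of the images and the resulting measure estimate\<close>

lemma P_interval:
  assumes "\<omega> \<in> P j"
  obtains u v where "u < v" "\<omega> = {u<..<v}"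
proof -
  have "bounded \<omega>" using parameter_interval(2) P_memD(6)[OF assms] bounded_subset by blast
  then show ?thesis using open_bounded_interval[of \<omega>] P_memD(2-4)[OF assms] that by blast
qed

text \<open>From this level on \<open>x j\<close> moves at speed at least \<open>2 * L\<close>,
  twice the Lipschitz constant of the partition curves, and across one parameter interval, of length
  at most \<open>C0 / lam ^ j\<close>, these curves move by at most
  \<open>\<delta>0 / 4\<close>.\<close>

definition j_min :: nat where
  "j_min = (SOME j. 1 \<le> j \<and> 2 * L * C0 \<le> lam ^ j \<and> 4 * L * C0 / \<delta>0 \<le> lam ^ j)"

lemma j_min: "1 \<le> j_min" "j_min \<le> j \<Longrightarrow> 2 * L * C0 \<le> lam ^ j" "j_min \<le> j \<Longrightarrow> 4 * L * C0 / \<delta>0 \<le> lam ^ j"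
proof -
  have "\<exists>j. 1 \<le> j \<and> 2 * L * C0 \<le> lam ^ j \<and> 4 * L * C0 / \<delta>0 \<le> lam ^ j"
  proof -
    obtain n where n: "max (2 * L * C0) (4 * L * C0 / \<delta>0) < lam ^ n"
      using real_arch_pow constants by blast
    also have "lam ^ n \<le> lam ^ (Suc n)" using constants by (intro power_increasing) auto
    finally show ?thesis by (intro exI[of _ "Suc n"]) auto
  qed
  then have *: "1 \<le> j_min \<and> 2 * L * C0 \<le> lam ^ j_min \<and> 4 * L * C0 / \<delta>0 \<le> lam ^ j_min"
    unfolding j_min_def by (rule someI_ex)
  then show "1 \<le> j_min" by blast
  assume "j_min \<le> j"
  then have "lam ^ j_min \<le> lam ^ j" using constants by (intro power_increasing) auto
  then show "2 * L * C0 \<le> lam ^ j" "4 * L * C0 / \<delta>0 \<le> lam ^ j" using * by auto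
qed

text \<open>An end point that is also an end of \<open>I\<close> need not correspond to a visit to
  the partition, so the image of such an interval may be short. These intervals are set
  aside.\<close>

definition inner_P :: "nat \<Rightarrow> real set set" where
  "inner_P j = {\<omega> \<in> P j. closure \<omega> \<subseteq> interior I}"

text \<open>At the two ends \<open>x j\<close> tends to partition points. They cannot be the same \<open>b a m\<close>, because
  \<open>x j\<close> moves faster than the Lipschitz curve \<open>b a m\<close>.\<close>

lemma inner_P_large_image:
  assumes \<omega>: "\<omega> \<in> inner_P j" and j: "j_min \<le> j"
  obtains a a' where "a \<in> \<omega>" "a' \<in> \<omega>" "\<delta>0 / 2 \<le> \<bar>x j a' - x j a\<bar>"
proof -
  have \<omega>P: "\<omega> \<in> P j" and sub: "closure \<omega> \<subseteq> interior I" using \<omega> by (auto simp: inner_P_def)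
  have j1: "1 \<le> j" using j j_min(1) by simp
  obtain u v where uv: "u < v" "\<omega> = {u<..<v}" using P_interval[OF \<omega>P] .
  then have cl: "u \<in> closure \<omega>" "v \<in> closure \<omega>" "u \<notin> \<omega>" "v \<notin> \<omega>" by simp_all
  then have int: "u \<in> interior I" "v \<in> interior I" using sub by auto
  \<comment> \<open>With different partition points the image has length at least
    \<open>\<delta>0\<close>, less \<open>\<delta>0 / 4\<close> for the motion of the curve and
    \<open>2 * \<epsilon>\<close> for the approximation, hence the bound
    \<open>\<delta>0 / 8\<close>. With equal ones the speed of \<open>x j\<close> forces
    \<open>L * \<bar>a' - a\<bar> < 2 * \<epsilon>\<close>, which the second bound excludes for
    points within \<open>\<epsilon>\<close> of the two ends.\<close>
  define \<epsilon> where "\<epsilon> = min (\<delta>0 / 8) (L * (v - u) / (4 * L + 4))"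
  have L: "L > 0" using constants by simp
  have \<epsilon>: "\<epsilon> > 0" using \<delta>0_pos L uv(1) by (simp add: \<epsilon>_def)
  have \<epsilon>1: "\<epsilon> \<le> \<delta>0 / 8" unfolding \<epsilon>_def by (rule min.cobounded1)
  have "\<epsilon> \<le> L * (v - u) / (4 * L + 4)" by (simp add: \<epsilon>_def)
  then have \<epsilon>2: "\<epsilon> * (4 * L + 4) \<le> L * (v - u)" using L by (simp add: pos_le_divide_eq)
  obtain a m where a: "a \<in> \<omega>" "\<bar>a - u\<bar> < \<epsilon>" "m \<le> p0" "\<bar>x j a - b a m\<bar> < \<epsilon>"
    using x_near_partition_at_endpoint[OF int(1) \<omega>P cl(1,3) j1 \<epsilon>] .
  obtain a' m' where a': "a' \<in> \<omega>" "\<bar>a' - v\<bar> < \<epsilon>" "m' \<le> p0" "\<bar>x j a' - b a' m'\<bar> < \<epsilon>"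
    using x_near_partition_at_endpoint[OF int(2) \<omega>P cl(2,4) j1 \<epsilon>] .
  have aI: "a \<in> I" "a' \<in> I" using P_memD(6)[OF \<omega>P] a a' by auto
  have lip: "\<bar>b a' m - b a m\<bar> \<le> L * \<bar>a' - a\<bar>"
    using lipschitz_onD[OF b_lipschitz[OF a(3)] aI(2,1)] by (simp add: dist_real_def)
  have C0: "C0 > 0" using C0_ge_1 by simp
  show ?thesis
  proof (cases "m = m'")
    case True
    have "2 * L * \<bar>a' - a\<bar> \<le> lam ^ j / C0 * \<bar>a' - a\<bar>"
      using j_min(2)[OF j] C0 by (intro mult_right_mono) (auto simp: field_simps)
    also have "\<dots> \<le> \<bar>x j a' - x j a\<bar>"
      using x_increment_growth(2)[OF \<omega>P a(1) a'(1), of j] j1 lam_pos C0 by (simp add: field_simps)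
    also have "\<dots> < 2 * \<epsilon> + L * \<bar>a' - a\<bar>" using a(4) a'(4)[folded True] lip by linarith
    finally have "L * \<bar>a' - a\<bar> < 2 * \<epsilon>" by simp
    moreover have "L * (v - u - 2 * \<epsilon>) \<le> L * \<bar>a' - a\<bar>" using a(2) a'(2) L by (intro mult_left_mono) auto
    ultimately have "L * (v - u) < 2 * \<epsilon> + 2 * L * \<epsilon>" by (simp add: algebra_simps)
    also have "\<dots> \<le> \<epsilon> * (4 * L + 4)" using \<epsilon> L by (simp add: algebra_simps)
    finally show ?thesis using \<epsilon>2 by simp
  next
    case False
    have "\<delta>0 \<le> \<bar>b a' m' - b a' m\<bar>"
      using b_separated[OF aI(2), of m m'] b_separated[OF aI(2), of m' m] False a(3) a'(3)
      by (cases "m < m'") auto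
    moreover have "L * \<bar>a' - a\<bar> \<le> \<delta>0 / 4"
    proof -
      have "L * \<bar>a' - a\<bar> \<le> L * (C0 / lam ^ j)"
        using P_small(2)[OF \<omega>P a(1) a'(1), of j] j1 L by (intro mult_left_mono) auto
      also have "\<dots> \<le> \<delta>0 / 4" using j_min(3)[OF j] \<delta>0_pos lam_pos by (simp add: field_simps)
      finally show ?thesis .
    qed
    ultimately have "\<delta>0 / 2 \<le> \<bar>x j a' - x j a\<bar>" using lip a(4) a'(4) \<epsilon>1 by linarith
    then show ?thesis using that a a' by blast
  qed
qed

text \<open>The distortion divided by the least image length \<open>\<delta>0 / 2\<close>.\<close>

definition density_const :: real where
  "density_const = 2 * distortion / \<delta>0"

lemma distortion_pos: "0 < distortion" and density_const_pos: "0 < density_const"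
  using C0_ge_1 Lam_pos \<delta>0_pos by (simp_all add: distortion_def density_const_def)

text \<open>Since the image of \<open>\<omega>\<close> has length at least
  \<open>\<delta>0 / 2\<close>, the derivative of \<open>x j\<close> is at least
  \<open>\<delta>0 / 2\<close> over the length of \<open>\<omega>\<close> at some point, hence
  everywhere up to the distortion. A set whose image has diameter \<open>r\<close> thus has diameter
  at most \<open>density_const * r\<close> times that length.\<close>

lemma inner_P_measure_bound:
  assumes \<omega>: "\<omega> \<in> inner_P j" and j: "j_min \<le> j" and "0 \<le> r"
    and S: "S \<subseteq> \<omega>" "\<And>s t. s \<in> S \<Longrightarrow> t \<in> S \<Longrightarrow> \<bar>x j s - x j t\<bar> \<le> r"
  shows "emeasure lborel S \<le> ennreal (density_const * r) * emeasure lborel \<omega>"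
proof -
  have \<omega>P: "\<omega> \<in> P j" using \<omega> by (auto simp: inner_P_def)
  have j1: "1 \<le> j" using j j_min(1) by simp
  obtain u v where uv: "u < v" "\<omega> = {u<..<v}" using P_interval[OF \<omega>P] .
  obtain a a' where a: "a \<in> \<omega>" "a' \<in> \<omega>" "\<delta>0 / 2 \<le> \<bar>x j a' - x j a\<bar>"
    using inner_P_large_image[OF \<omega> j] .
  have diff: "x j field_differentiable at c" if "c \<in> \<omega>" for c
    using x_differentiable_P[OF \<omega>P that] by simp
  obtain c where c: "c \<in> \<omega>" "x j a' - x j a = (a' - a) * deriv (x j) c"
    using mvt_deriv[OF P_memD(3)[OF \<omega>P] a(1,2) diff] by blast
  have "\<bar>x j a' - x j a\<bar> \<le> (v - u) * \<bar>deriv (x j) c\<bar>"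
    unfolding c(2) abs_mult using a uv by (intro mult_right_mono) auto
  then have big: "\<delta>0 / 2 \<le> (v - u) * \<bar>deriv (x j) c\<bar>" using a(3) by linarith
  have "\<bar>s - t\<bar> \<le> density_const * r * (v - u)" if st: "s \<in> S" "t \<in> S" for s t
  proof -
    obtain d where d: "d \<in> \<omega>" "x j t - x j s = (t - s) * deriv (x j) d"
      using mvt_deriv[OF P_memD(3)[OF \<omega>P] _ _ diff, of s t] st S(1) by blast
    have "\<bar>t - s\<bar> * \<bar>deriv (x j) d\<bar> \<le> r"
      using S(2)[OF st(2,1)] d(2) by (simp add: abs_mult)
    moreover have "\<bar>deriv (x j) c\<bar> \<le> distortion * \<bar>deriv (x j) d\<bar>"
      by (rule distortion_bound[OF \<omega>P c(1) d(1) j1])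
    ultimately have "\<bar>t - s\<bar> * \<bar>deriv (x j) c\<bar> \<le> distortion * r"
      using mult_left_mono[of "\<bar>deriv (x j) c\<bar>" "distortion * \<bar>deriv (x j) d\<bar>" "\<bar>t - s\<bar>"]
        mult_left_mono[of "\<bar>t - s\<bar> * \<bar>deriv (x j) d\<bar>" r distortion] distortion_pos
      by (smt (verit, ccfv_threshold) mult.assoc mult.commute abs_ge_zero)
    then have "\<bar>t - s\<bar> * \<bar>deriv (x j) c\<bar> * (v - u) \<le> distortion * r * (v - u)"
      using uv by (intro mult_right_mono) auto
    moreover have "\<bar>t - s\<bar> * (\<delta>0 / 2) \<le> \<bar>t - s\<bar> * ((v - u) * \<bar>deriv (x j) c\<bar>)"
      using big by (intro mult_left_mono) auto
    ultimately have "\<bar>t - s\<bar> * (\<delta>0 / 2) \<le> distortion * r * (v - u)" by (simp add: mult_ac)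
    then show ?thesis using \<delta>0_pos
      by (simp add: density_const_def field_simps abs_minus_commute)
  qed
  moreover have "0 \<le> density_const * r * (v - u)" using density_const_pos uv \<open>0 \<le> r\<close> by simp
  ultimately have "emeasure lborel S \<le> ennreal (density_const * r * (v - u))"
    by (rule emeasure_le_if_diameter_le)
  also have "\<dots> = ennreal (density_const * r) * emeasure lborel \<omega>"
    using uv density_const_pos \<open>0 \<le> r\<close> by (simp add: ennreal_mult)
  finally show ?thesis .
qed

end

section \<open>Visit frequencies\<close>

text \<open>The integrand is 2 to the number of visited sets. Independence is replaced by a
  conditional bound: the past \<open>G i\<close>, \<open>i < n\<close>, is constant on each element
  of \<open>Q n\<close>, and \<open>G n\<close> occupies at most the fraction \<open>q\<close> of
  it. Each step therefore multiplies the integral by at most \<open>1 + q\<close>.\<close>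

lemma exponential_moment_bound:
  fixes M :: "'a measure" and G :: "nat \<Rightarrow> 'a set" and Q :: "nat \<Rightarrow> 'a set set" and q :: ennreal
  assumes G [measurable]: "\<And>n. G n \<in> sets M"
    and Q: "\<And>n. countable (Q n)" "\<And>n. disjoint (Q n)" "\<And>n. Q n \<subseteq> sets M"
    and cover: "\<And>n. AE z in M. z \<in> \<Union>(Q n)"
    and const: "\<And>n i \<omega>. \<omega> \<in> Q n \<Longrightarrow> i < n \<Longrightarrow> \<omega> \<subseteq> G i \<or> \<omega> \<inter> G i = {}"
    and small: "\<And>n \<omega>. \<omega> \<in> Q n \<Longrightarrow> emeasure M (\<omega> \<inter> G n) \<le> q * emeasure M \<omega>"
  shows "(\<integral>\<^sup>+z. (\<Prod>i<n. 1 + indicator (G i) z) \<partial>M) \<le> (1 + q) ^ n * emeasure M (space M)"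
proof (induction n)
  case (Suc n)
  define W :: "'a \<Rightarrow> ennreal" where "W z = (\<Prod>i<n. 1 + indicator (G i) z)" for z
  have W [measurable]: "W \<in> borel_measurable M" unfolding W_def by measurable
  have Qs: "\<omega> \<in> sets M" if "\<omega> \<in> Q n" for \<omega> using Q(3) that by blast
  have UQ [measurable]: "\<Union>(Q n) \<in> sets M" using Q(1) Qs by (intro sets.countable_Union) auto
  let ?D = "density M W"
  have disj: "disjoint_family_on (\<lambda>\<omega>. \<omega>) (Q n)" "disjoint_family_on (\<lambda>\<omega>. \<omega> \<inter> G n) (Q n)"
    using Q(2)[of n] by (auto simp: disjoint_family_on_def disjoint_def)
  have piece: "emeasure ?D (\<omega> \<inter> G n) \<le> q * emeasure ?D \<omega>" if \<omega>: "\<omega> \<in> Q n" for \<omega>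
  proof (cases "\<omega> = {}")
    case False
    then obtain z0 where z0: "z0 \<in> \<omega>" by blast
    have "indicator (G i) z = (indicator (G i) z0 :: ennreal)" if "z \<in> \<omega>" "i < n" for z i
      using const[OF \<omega> that(2)] that(1) z0 by (auto simp: indicator_def)
    \<comment> \<open>On \<open>\<omega>\<close> the weighted measure is a constant multiple of
      \<open>M\<close>, so the fraction bound for \<open>G n\<close> survives the weighting.\<close>
    then have W_const: "W z = W z0" if "z \<in> \<omega>" for z
      unfolding W_def using that by (intro prod.cong) auto
    have dens: "emeasure ?D B = W z0 * emeasure M B" if B: "B \<in> sets M" "B \<subseteq> \<omega>" for B
    proof -
      have "emeasure ?D B = (\<integral>\<^sup>+z. W z * indicator B z \<partial>M)" using B by (simp add: emeasure_density)
      also have "\<dots> = (\<integral>\<^sup>+z. W z0 * indicator B z \<partial>M)"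
        using W_const B(2) by (intro nn_integral_cong) (auto simp: indicator_def)
      finally show ?thesis using B(1) by (simp add: nn_integral_cmult_indicator)
    qed
    have "emeasure ?D (\<omega> \<inter> G n) = W z0 * emeasure M (\<omega> \<inter> G n)"
      using Qs[OF \<omega>] by (intro dens) auto
    also have "\<dots> \<le> W z0 * (q * emeasure M \<omega>)" using small[OF \<omega>] by (intro mult_left_mono) auto
    also have "\<dots> = q * emeasure ?D \<omega>" using dens[OF Qs[OF \<omega>]] by (simp add: mult_ac)
    finally show ?thesis .
  qed simp
  have "(\<integral>\<^sup>+z. W z * indicator (G n) z \<partial>M) = (\<integral>\<^sup>+z. W z * indicator (\<Union>(Q n) \<inter> G n) z \<partial>M)"
    using cover[of n] by (intro nn_integral_cong_AE) (auto simp: indicator_def elim: eventually_mono)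
  also have "\<dots> = emeasure ?D (\<Union>(Q n) \<inter> G n)" by (simp add: emeasure_density)
  also have "\<Union>(Q n) \<inter> G n = (\<Union>\<omega>\<in>Q n. \<omega> \<inter> G n)" by auto
  also have "emeasure ?D \<dots> = (\<integral>\<^sup>+\<omega>. emeasure ?D (\<omega> \<inter> G n) \<partial>count_space (Q n))"
    using Qs Q(1) disj by (intro emeasure_UN_countable) auto
  also have "\<dots> \<le> (\<integral>\<^sup>+\<omega>. q * emeasure ?D \<omega> \<partial>count_space (Q n))"
    using piece by (intro nn_integral_mono) simp
  also have "\<dots> = q * (\<integral>\<^sup>+\<omega>. emeasure ?D \<omega> \<partial>count_space (Q n))"
    by (simp add: nn_integral_cmult)
  also have "(\<integral>\<^sup>+\<omega>. emeasure ?D \<omega> \<partial>count_space (Q n)) = emeasure ?D (\<Union>\<omega>\<in>Q n. \<omega>)"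
    using Qs Q(1) disj by (intro emeasure_UN_countable[symmetric]) auto
  also have "\<dots> \<le> emeasure ?D (space M)"
    using UQ sets.sets_into_space[OF UQ] by (intro emeasure_mono) auto
  also have "\<dots> = (\<integral>\<^sup>+z. W z \<partial>M)"
    by (simp add: emeasure_density cong: nn_integral_cong)
  finally have step: "(\<integral>\<^sup>+z. W z * indicator (G n) z \<partial>M) \<le> q * (\<integral>\<^sup>+z. W z \<partial>M)"
    by (simp add: mult_left_mono)
  have "(\<integral>\<^sup>+z. (\<Prod>i<Suc n. 1 + indicator (G i) z) \<partial>M) = (\<integral>\<^sup>+z. W z + W z * indicator (G n) z \<partial>M)"
    unfolding W_def by (intro nn_integral_cong) (simp add: distrib_left)
  also have "\<dots> = (\<integral>\<^sup>+z. W z \<partial>M) + (\<integral>\<^sup>+z. W z * indicator (G n) z \<partial>M)"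
    by (intro nn_integral_add) auto
  also have "\<dots> \<le> (1 + q) * (\<integral>\<^sup>+z. W z \<partial>M)"
    using step by (simp add: distrib_right)
  also have "\<dots> \<le> (1 + q) * ((1 + q) ^ n * emeasure M (space M))"
    using Suc.IH unfolding W_def by (intro mult_left_mono) auto
  finally show ?case by (simp add: mult.assoc)
qed simp

text \<open>By Markov's inequality, exceeding the frequency \<open>2 * q\<close> up to time
  \<open>n\<close> has measure at most a geometric term in \<open>n\<close>, and Borel--Cantelli
  applies.\<close>

lemma AE_visit_frequency_le:
  fixes M :: "'a measure" and G :: "nat \<Rightarrow> 'a set" and Q :: "nat \<Rightarrow> 'a set set" and q :: real
  assumes "finite_measure M" "0 < q"
    and G [measurable]: "\<And>n. G n \<in> sets M"
    and Q: "\<And>n. countable (Q n)" "\<And>n. disjoint (Q n)" "\<And>n. Q n \<subseteq> sets M"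
    and cover: "\<And>n. AE z in M. z \<in> \<Union>(Q n)"
    and const: "\<And>n i \<omega>. \<omega> \<in> Q n \<Longrightarrow> i < n \<Longrightarrow> \<omega> \<subseteq> G i \<or> \<omega> \<inter> G i = {}"
    and small: "\<And>n \<omega>. \<omega> \<in> Q n \<Longrightarrow> emeasure M (\<omega> \<inter> G n) \<le> ennreal q * emeasure M \<omega>"
  shows "AE z in M. \<forall>\<^sub>F n in sequentially. real (card {i. i < n \<and> z \<in> G i}) \<le> 2 * q * n"
proof -
  interpret finite_measure M by fact
  define W :: "nat \<Rightarrow> 'a \<Rightarrow> ennreal" where "W n z = (\<Prod>i<n. 1 + indicator (G i) z)" for n z
  have W_meas [measurable]: "W n \<in> borel_measurable M" for n unfolding W_def by measurable
  have W_eq: "W n z = ennreal (2 powr real (card {i. i < n \<and> z \<in> G i}))" for n z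
  proof -
    have "W n z = (\<Prod>i<n. if z \<in> G i then 2 else 1)"
      unfolding W_def by (intro prod.cong) auto
    also have "\<dots> = 2 ^ card ({..<n} \<inter> {i. z \<in> G i})"
      by (simp add: prod.If_cases)
    also have "{..<n} \<inter> {i. z \<in> G i} = {i. i < n \<and> z \<in> G i}" by auto
    finally show ?thesis by (simp add: powr_realpow ennreal_power[symmetric])
  qed
  \<comment> \<open>The ratio of moment growth to threshold growth. It is below 1 for every positive
    \<open>q\<close>, since \<open>1 + q \<le> exp q\<close> and \<open>1 < ln 4\<close>.\<close>
  define \<rho> where "\<rho> = (1 + q) / 2 powr (2 * q)"
  have \<rho>: "0 \<le> \<rho>" "\<rho> < 1"
  proof -
    have "exp (1::real) < 4" using exp_le by simp
    then have "1 < ln (4::real)" by (metis exp_gt_zero ln_exp ln_less_cancel_iff zero_less_numeral)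
    also have "ln (4::real) = 2 * ln 2" using ln_realpow[of 2 2] by simp
    finally have "q * 1 < q * (2 * ln 2)" using \<open>0 < q\<close> by (intro mult_strict_left_mono) auto
    then have "exp q < 2 powr (2 * q)" by (simp add: powr_def mult_ac)
    with exp_ge_add_one_self[of q] have "1 + q < 2 powr (2 * q)" by linarith
    then show "\<rho> < 1" by (simp add: \<rho>_def)
    show "0 \<le> \<rho>" using \<open>0 < q\<close> by (simp add: \<rho>_def)
  qed
  define A where "A n = {z \<in> space M. ennreal (2 powr (2 * q * n)) \<le> W n z}" for n
  have A_meas [measurable]: "A n \<in> sets M" for n unfolding A_def by measurable
  have bound: "measure M (A n) \<le> \<rho> ^ n * measure M (space M)" for n
  proof -
    have "ennreal (2 powr (2 * q * n)) * emeasure M (A n)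
        = (\<integral>\<^sup>+z. ennreal (2 powr (2 * q * n)) * indicator (A n) z \<partial>M)"
      by (simp add: nn_integral_cmult_indicator)
    also have "\<dots> \<le> (\<integral>\<^sup>+z. W n z \<partial>M)"
      by (intro nn_integral_mono) (auto simp: A_def indicator_def)
    also have "\<dots> \<le> (1 + ennreal q) ^ n * emeasure M (space M)"
      unfolding W_def using G Q cover const small by (rule exponential_moment_bound)
    also have "\<dots> = ennreal ((1 + q) ^ n * measure M (space M))"
      using \<open>0 < q\<close> by (simp add: emeasure_eq_measure ennreal_mult ennreal_power[symmetric] flip: ennreal_1)
    finally have "ennreal (2 powr (2 * q * n) * measure M (A n)) \<le> ennreal ((1 + q) ^ n * measure M (space M))"
      by (simp add: emeasure_eq_measure ennreal_mult)
    then have "2 powr (2 * q * n) * measure M (A n) \<le> (1 + q) ^ n * measure M (space M)"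
      using \<open>0 < q\<close> by (subst (asm) ennreal_le_iff) auto
    moreover have "2 powr (2 * q * n) = (2 powr (2 * q)) ^ n"
      by (simp add: powr_realpow[symmetric] powr_powr)
    ultimately show ?thesis
      by (simp add: \<rho>_def power_divide field_simps)
  qed
  have "AE z in M. \<forall>\<^sub>F n in sequentially. z \<in> space M - A n"
  proof (rule borel_cantelli_AE1)
    show "summable (\<lambda>n. measure M (A n))"
    proof (rule summable_comparison_test')
      show "summable (\<lambda>n. \<rho> ^ n * measure M (space M))"
        using \<rho> by (intro summable_mult2 summable_geometric) auto
      show "\<And>n. 0 \<le> n \<Longrightarrow> norm (measure M (A n)) \<le> \<rho> ^ n * measure M (space M)" using bound by simp
    qed
  qed (auto simp: emeasure_eq_measure)
  then show ?thesis
  proof eventually_elim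
    case (elim z)
    then show ?case
    proof eventually_elim
      case (elim n)
      then have "W n z < ennreal (2 powr (2 * q * n))" by (auto simp: A_def)
      then have "2 powr real (card {i. i < n \<and> z \<in> G i}) < 2 powr (2 * q * n)"
        unfolding W_eq by (simp add: ennreal_less_iff)
      then show ?case by simp
    qed
  qed
qed

text \<open>Each residue class has at most \<open>n div m + 1\<close> members between
  \<open>j0\<close> and \<open>n\<close>. The factor 2 absorbs the first \<open>j0\<close> times and
  the rounding error \<open>K * m\<close>, both bounded in \<open>n\<close>.\<close>

lemma frequency_le_if_residue_classes:
  fixes A :: "nat set" and K :: real
  assumes "0 < m" "0 < K"
    and res: "\<And>s. s < m \<Longrightarrow> \<forall>\<^sub>F n in sequentially. real (card {i. i < n \<and> j0 + s + i * m \<in> A}) \<le> K * n"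
  shows "\<forall>\<^sub>F n in sequentially. real (card {k. k < n \<and> k \<in> A}) \<le> 2 * K * n"
proof -
  have "\<forall>\<^sub>F n in sequentially. \<forall>s\<in>{..<m}. real (card {i. i < n \<and> j0 + s + i * m \<in> A}) \<le> K * n"
    using res by (intro eventually_ball_finite) auto
  then obtain N where N: "\<And>n s. N \<le> n \<Longrightarrow> s < m \<Longrightarrow> real (card {i. i < n \<and> j0 + s + i * m \<in> A}) \<le> K * n"
    unfolding eventually_sequentially by auto
  obtain N' where N': "real N' \<ge> (j0 + K * m) / K" using real_arch_simple by blast
  show ?thesis
    unfolding eventually_sequentially
  proof (intro exI[of _ "max (N * m) N'"] allI impI)
    fix n assume n: "max (N * m) N' \<le> n"
    define l where "l = n div m + 1"
    define B where "B s = {i. i < l \<and> j0 + s + i * m \<in> A}" for s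
    have finB: "finite (B s)" for s unfolding B_def by simp
    have "N \<le> n div m" using n \<open>0 < m\<close> by (simp add: less_eq_div_iff_mult_less_eq)
    then have "N \<le> l" by (simp add: l_def)
    have "{k. k < n \<and> k \<in> A} \<subseteq> {..<j0} \<union> (\<Union>s<m. (\<lambda>i. j0 + s + i * m) ` B s)"
    proof
      fix k assume k: "k \<in> {k. k < n \<and> k \<in> A}"
      show "k \<in> {..<j0} \<union> (\<Union>s<m. (\<lambda>i. j0 + s + i * m) ` B s)"
      proof (cases "k < j0")
        case False
        define i s where "i = (k - j0) div m" and "s = (k - j0) mod m"
        have eq: "k = j0 + s + i * m" using False by (simp add: i_def s_def)
        have "i \<le> n div m" unfolding i_def using k by (intro div_le_mono) auto
        then have "i \<in> B s" using k eq by (simp add: B_def l_def)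
        moreover have "s < m" using \<open>0 < m\<close> by (simp add: s_def)
        ultimately show ?thesis using eq by blast
      qed simp
    qed
    then have "card {k. k < n \<and> k \<in> A} \<le> card ({..<j0} \<union> (\<Union>s<m. (\<lambda>i. j0 + s + i * m) ` B s))"
      using finB by (intro card_mono) auto
    also have "\<dots> \<le> card {..<j0} + card (\<Union>s<m. (\<lambda>i. j0 + s + i * m) ` B s)" by (rule card_Un_le)
    also have "card (\<Union>s<m. (\<lambda>i. j0 + s + i * m) ` B s) \<le> (\<Sum>s<m. card ((\<lambda>i. j0 + s + i * m) ` B s))"
      by (rule card_UN_le) simp
    also have "\<dots> \<le> (\<Sum>s<m. card (B s))" using finB by (intro sum_mono card_image_le)
    finally have "card {k. k < n \<and> k \<in> A} \<le> j0 + (\<Sum>s<m. card (B s))" by simp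
    then have "real (card {k. k < n \<and> k \<in> A}) \<le> real j0 + (\<Sum>s<m. real (card (B s)))"
      by (metis of_nat_add of_nat_le_iff of_nat_sum)
    also have "(\<Sum>s<m. real (card (B s))) \<le> (\<Sum>s<m. K * l)"
      unfolding B_def using N \<open>N \<le> l\<close> by (intro sum_mono) auto
    also have "(\<Sum>s<m. K * l) = K * (real (n div m * m) + m)" by (simp add: l_def algebra_simps)
    also have "\<dots> \<le> K * (real n + m)"
      using \<open>0 < K\<close> by (intro mult_left_mono add_right_mono) (auto simp del: of_nat_mult)
    also have "real j0 + K * (real n + m) \<le> 2 * K * n"
    proof -
      have "(j0 + K * m) / K \<le> real n" using N' n by linarith
      then show ?thesis using \<open>0 < K\<close> by (simp add: field_simps)
    qed
    finally show "real (card {k. k < n \<and> k \<in> A}) \<le> 2 * K * n" by simp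
  qed
qed

section \<open>Visits of the orbits of \<open>X\<close> to a small interval\<close>

context markov_family
begin

lemma AE_P:
  assumes "\<omega>0 \<in> P j" "1 \<le> i"
  shows "AE a in restrict_space lborel \<omega>0. a \<in> \<Union>(P i)"
proof -
  have "\<omega>0 - \<Union>(P i) \<subseteq> I - \<Union>(P i)" using P_memD(6)[OF assms(1)] by blast
  then have "finite (\<omega>0 - \<Union>(P i))" using finite_exceptions[OF assms(2)] finite_subset by blast
  then have "\<omega>0 - \<Union>(P i) \<in> null_sets lborel" by (rule finite_imp_null_set_lborel)
  then have "AE a in lborel. a \<notin> \<omega>0 - \<Union>(P i)" by (rule AE_not_in)
  then show ?thesis using P_memD(2)[OF assms(1)]
    by (subst AE_restrict_space_iff) (auto elim: eventually_mono)
qed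

text \<open>The abstract bound is applied with \<open>q = 4 * density_const * r\<close>: the visit
  event is enlarged to distance \<open>2 * r\<close> from \<open>y\<close>, so its image under
  \<open>x (t n)\<close> has diameter at most \<open>4 * r\<close>. The threshold
  \<open>2 * q\<close> gives the 8.\<close>

lemma AE_visit_frequency_residue:
  assumes \<omega>0: "\<omega>0 \<in> inner_P j0" and j0: "j_min \<le> j0" and "0 < r"
    and m: "0 < m" "C0\<^sup>2 / lam ^ m \<le> r"
  shows "AE a in restrict_space lborel \<omega>0. \<forall>\<^sub>F n in sequentially.
    real (card {i. i < n \<and> j0 + s + i * m \<in> {k. \<bar>x k a - y\<bar> \<le> r}}) \<le> 8 * density_const * r * n"
proof -
  have \<omega>0P: "\<omega>0 \<in> P j0" and cl0: "closure \<omega>0 \<subseteq> interior I" using \<omega>0 by (auto simp: inner_P_def)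
  have j01: "1 \<le> j0" using j0 j_min(1) by simp
  define t where "t i = j0 + s + i * m" for i
  have t: "j0 \<le> t i" "1 \<le> t i" "t (Suc i) - t i = m" "t i \<le> t (Suc i)" for i
    using j01 by (auto simp: t_def)
  have t_mono: "t i \<le> t n" if "i \<le> n" for i n using that by (simp add: t_def)
  define M where "M = restrict_space lborel \<omega>0"
  define Q where "Q n = {\<omega> \<in> P (t n). \<omega> \<subseteq> \<omega>0}" for n
  \<comment> \<open>The visit event is replaced by the union of the next-level elements that meet
    it, which makes it open and constant on all later partitions. The gap \<open>m\<close> is so
    large that \<open>x (t n)\<close> varies by at most \<open>r\<close> on such an element.\<close>
  define G where "G n = \<Union>{\<omega> \<in> P (t (Suc n)). \<omega> \<subseteq> \<omega>0 \<and> (\<exists>a\<in>\<omega>. \<bar>x (t n) a - y\<bar> \<le> r)}" for n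
  have open0: "open \<omega>0" using P_memD(2)[OF \<omega>0P] .
  have space_M: "space M = \<omega>0" by (simp add: M_def space_restrict_space)
  have sets_M: "B \<in> sets M" if "open B" "B \<subseteq> \<omega>0" for B
    using that open0 by (auto simp: M_def sets_restrict_space_iff)
  have em: "emeasure M B = emeasure lborel B" if "B \<subseteq> \<omega>0" for B
    using that open0 by (simp add: M_def emeasure_restrict_space)
  have sub0: "\<omega> \<subseteq> \<omega>0" if \<omega>: "\<omega> \<in> P (t n)" and a: "a \<in> \<omega>" "a \<in> \<omega>0" for \<omega> n a
  proof -
    obtain \<omega>' where \<omega>': "\<omega>' \<in> P j0" "\<omega> \<subseteq> \<omega>'" using P_refines[OF \<omega> t(1)] .
    then have "\<omega>' = \<omega>0" using P_disjoint[OF \<omega>'(1) \<omega>0P] a by blast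
    then show ?thesis using \<omega>'(2) by simp
  qed
  have cover: "AE a in M. a \<in> \<Union>(Q n)" for n
    using AE_P[OF \<omega>0P t(2)[of n]] AE_space[of M]
    unfolding M_def[symmetric] space_M
  proof eventually_elim
    case (elim a)
    then obtain \<omega> where \<omega>: "\<omega> \<in> P (t n)" "a \<in> \<omega>" by blast
    moreover have "\<omega> \<subseteq> \<omega>0" using sub0[OF \<omega>] elim(2) by simp
    ultimately show ?case by (auto simp: Q_def)
  qed
  have G_sub: "G n \<subseteq> \<omega>0" "open (G n)" for n using P_memD(2) by (auto simp: G_def)
  have main: "AE a in M. \<forall>\<^sub>F n in sequentially.
      real (card {i. i < n \<and> a \<in> G i}) \<le> 2 * (4 * density_const * r) * n"
  proof (rule AE_visit_frequency_le[where Q = Q])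
    show "finite_measure M"
    proof (rule finite_measureI)
      obtain u v where "u < v" "\<omega>0 = {u<..<v}" using P_interval[OF \<omega>0P] .
      then show "emeasure M (space M) \<noteq> \<infinity>" using em[of \<omega>0] space_M by auto
    qed
    show "0 < 4 * density_const * r" using density_const_pos \<open>0 < r\<close> by simp
    show "G n \<in> sets M" for n using G_sub by (intro sets_M) auto
    show "countable (Q n)" for n
      using countable_P[of "t n"] by (rule countable_subset[rotated]) (auto simp: Q_def)
    show "disjoint (Q n)" for n
      using P_disjoint by (auto simp: Q_def intro!: disjointI)
    show "Q n \<subseteq> sets M" for n using P_memD(2) by (auto simp: Q_def intro!: sets_M)
    show "AE a in M. a \<in> \<Union>(Q n)" for n by (rule cover)
    show "\<omega> \<subseteq> G i \<or> \<omega> \<inter> G i = {}" if \<omega>: "\<omega> \<in> Q n" and i: "i < n" for n i \<omega>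
    proof -
      have "\<omega> \<in> P (t n)" "t (Suc i) \<le> t n" using \<omega> t_mono[of "Suc i" n] i by (auto simp: Q_def)
      then obtain \<omega>' where \<omega>': "\<omega>' \<in> P (t (Suc i))" "\<omega> \<subseteq> \<omega>'" by (rule P_refines)
      show ?thesis
      proof (cases "\<omega> \<inter> G i = {}")
        case False
        then obtain \<omega>'' where "\<omega>'' \<in> P (t (Suc i))" "\<omega>'' \<subseteq> G i" "\<omega> \<inter> \<omega>'' \<noteq> {}"
          unfolding G_def by blast
        then show ?thesis using P_disjoint[OF \<omega>'(1)] \<omega>'(2) by blast
      qed simp
    qed
    show "emeasure M (\<omega> \<inter> G n) \<le> ennreal (4 * density_const * r) * emeasure M \<omega>"
      if \<omega>: "\<omega> \<in> Q n" for n \<omega>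
    proof -
      have \<omega>': "\<omega> \<in> P (t n)" "\<omega> \<subseteq> \<omega>0" using \<omega> by (auto simp: Q_def)
      then have inner: "\<omega> \<in> inner_P (t n)" using closure_mono[OF \<omega>'(2)] cl0 by (auto simp: inner_P_def)
      have near: "\<bar>x (t n) a - y\<bar> \<le> 2 * r" if "a \<in> \<omega> \<inter> G n" for a
      proof -
        obtain \<omega>'' a' where \<omega>'': "\<omega>'' \<in> P (t (Suc n))" "a \<in> \<omega>''" "a' \<in> \<omega>''" "\<bar>x (t n) a' - y\<bar> \<le> r"
          using \<open>a \<in> \<omega> \<inter> G n\<close> by (auto simp: G_def)
        have "\<bar>x (t n) a' - x (t n) a\<bar> \<le> C0\<^sup>2 / lam ^ m"
          using P_small(1)[OF \<omega>''(1-3), of "t n"] t by simp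
        then show ?thesis using \<omega>''(4) m(2) by linarith
      qed
      have "emeasure lborel (\<omega> \<inter> G n) \<le> ennreal (density_const * (4 * r)) * emeasure lborel \<omega>"
      proof (rule inner_P_measure_bound[OF inner])
        show "j_min \<le> t n" using j0 t(1)[of n] by simp
        show "\<bar>x (t n) a - x (t n) a'\<bar> \<le> 4 * r" if "a \<in> \<omega> \<inter> G n" "a' \<in> \<omega> \<inter> G n" for a a'
          using near[OF that(1)] near[OF that(2)] by linarith
      qed (use \<open>0 < r\<close> in auto)
      moreover have "emeasure M (\<omega> \<inter> G n) = emeasure lborel (\<omega> \<inter> G n)" "emeasure M \<omega> = emeasure lborel \<omega>"
        using \<omega>'(2) by (auto intro!: em)
      ultimately show ?thesis by (simp add: mult_ac)
    qed
  qed
  have "AE a in M. \<forall>n. a \<in> \<Union>(Q n)" using cover by (simp add: AE_all_countable)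
  with main have "AE a in M. \<forall>\<^sub>F n in sequentially.
      real (card {i. i < n \<and> t i \<in> {k. \<bar>x k a - y\<bar> \<le> r}}) \<le> 8 * density_const * r * n"
  proof eventually_elim
    case (elim a)
    \<comment> \<open>Only this inclusion is wanted, since \<open>G\<close> may overcount visits. It
      holds at parameters lying in an element of every level, hence almost everywhere.\<close>
    have "i \<in> {i. a \<in> G i}" if "t i \<in> {k. \<bar>x k a - y\<bar> \<le> r}" for i
      using elim(2)[rule_format, of "Suc i"] that by (auto simp: G_def Q_def)
    then have sub: "{i. i < n \<and> t i \<in> {k. \<bar>x k a - y\<bar> \<le> r}} \<subseteq> {i. i < n \<and> a \<in> G i}" for n by blast
    have le: "card {i. i < n \<and> t i \<in> {k. \<bar>x k a - y\<bar> \<le> r}} \<le> card {i. i < n \<and> a \<in> G i}" for n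
      using sub by (intro card_mono) auto
    show ?case using elim(1)
    proof eventually_elim
      case (elim n)
      then show ?case using le[of n] by simp
    qed
  qed
  then show ?thesis unfolding M_def t_def .
qed

text \<open>The gap depends on \<open>r\<close>, but it affects only how large \<open>n\<close> must
  be: the bound stays linear in \<open>r\<close> with one constant for all intervals.\<close>

lemma AE_visit_frequency:
  assumes \<omega>0: "\<omega>0 \<in> inner_P j0" and j0: "j_min \<le> j0" and r: "0 < r"
  shows "AE a in restrict_space lborel \<omega>0. \<forall>\<^sub>F n in sequentially.
    real (card {k. k < n \<and> \<bar>x k a - y\<bar> \<le> r}) \<le> 16 * density_const * r * n"
proof -
  obtain m0 where "C0\<^sup>2 / r < lam ^ m0" using real_arch_pow constants by blast
  also have "lam ^ m0 \<le> lam ^ Suc m0" using constants by (intro power_increasing) auto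
  finally have m: "C0\<^sup>2 / lam ^ Suc m0 \<le> r" using r lam_pos by (simp add: field_simps)
  have "AE a in restrict_space lborel \<omega>0. \<forall>s. \<forall>\<^sub>F n in sequentially.
    real (card {i. i < n \<and> j0 + s + i * Suc m0 \<in> {k. \<bar>x k a - y\<bar> \<le> r}}) \<le> 8 * density_const * r * n"
    unfolding AE_all_countable
    using AE_visit_frequency_residue[OF \<omega>0 j0 r _ m] by blast
  then show ?thesis
  proof eventually_elim
    case (elim a)
    have "0 < 8 * density_const * r" using density_const_pos r by simp
    then show ?case
      using frequency_le_if_residue_classes[of "Suc m0" "8 * density_const * r" j0 "{k. \<bar>x k a - y\<bar> \<le> r}"]
        elim by (simp add: mult.assoc)
  qed
qed

text \<open>The elements containing \<open>a\<close> have length at most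
  \<open>C0 / lam ^ j\<close>, so eventually their closures stay within a fixed neighbourhood of
  \<open>a\<close> in the interior of \<open>I\<close>.\<close>

lemma inner_P_exists:
  assumes a: "a \<in> interior I" and "\<And>j. 1 \<le> j \<Longrightarrow> a \<in> \<Union>(P j)"
  obtains j \<omega> where "j_min \<le> j" "\<omega> \<in> inner_P j" "a \<in> \<omega>"
proof -
  obtain e where e: "e > 0" "cball a e \<subseteq> interior I"
    using a open_contains_cball open_interior by blast
  obtain n where n: "C0 / e < lam ^ n" using real_arch_pow constants by blast
  define j where "j = max j_min n"
  have j: "j_min \<le> j" "1 \<le> j" using j_min(1) by (auto simp: j_def)
  have "lam ^ n \<le> lam ^ j" using constants by (intro power_increasing) (auto simp: j_def)
  then have "C0 / e \<le> lam ^ j" using n by linarith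
  then have small: "C0 / lam ^ j \<le> e" using e(1) lam_pos by (simp add: field_simps)
  obtain \<omega> where \<omega>: "\<omega> \<in> P j" "a \<in> \<omega>" using assms(2)[OF j(2)] by blast
  have "\<omega> \<subseteq> cball a e"
  proof
    fix a' assume "a' \<in> \<omega>"
    then have "\<bar>a' - a\<bar> \<le> C0 / lam ^ j" using P_small(2)[OF \<omega>, of a' 1] j by simp
    then show "a' \<in> cball a e" using small by (simp add: dist_real_def)
  qed
  then have "closure \<omega> \<subseteq> cball a e" by (rule closure_minimal) simp
  then have "\<omega> \<in> inner_P j" using \<omega> e(2) by (auto simp: inner_P_def)
  then show ?thesis using that j \<omega> by blast
qed

end

section \<open>Weak limits of empirical measures\<close>

lemma emeasure_open_le_if_intervals_le:
  fixes N :: "real measure" and U :: "real set"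
  assumes sets: "sets N = sets borel" and "open U" "bounded U"
    and le: "\<And>u v. u < v \<Longrightarrow> emeasure N {u<..<v} \<le> ennreal (C * (v - u))" and "0 \<le> C"
  shows "emeasure N U \<le> ennreal C * emeasure lborel U"
proof -
  define D where "D = components U"
  have open_D: "open S" if "S \<in> D" for S
    using that \<open>open U\<close> open_components unfolding D_def by blast
  have disj: "pairwise disjnt D"
    using pairwise_disjoint_components[of U] unfolding D_def pairwise_def disjnt_def by blast
  have count: "countable D" using open_D disj by (rule countable_disjoint_open_subsets)
  have fam: "disjoint_family_on (\<lambda>S. S) D"
    using disj by (auto simp: disjoint_family_on_def pairwise_def disjnt_def)
  have U: "U = (\<Union>S\<in>D. S)" using Union_components[of U] by (simp add: D_def)
  have piece: "emeasure N S \<le> ennreal C * emeasure lborel S" if S: "S \<in> D" for S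
  proof -
    have "S \<noteq> {}" "connected S" "S \<subseteq> U"
      using S in_components_nonempty in_components_connected in_components_subset unfolding D_def by blast+
    moreover from this have "bounded S" using \<open>bounded U\<close> bounded_subset by blast
    ultimately have eq: "S = {Inf S<..<Sup S}" "Inf S < Sup S"
      using open_bounded_interval[OF open_D[OF S]] by (auto simp: is_interval_connected_1)
    have "emeasure N {Inf S<..<Sup S} \<le> ennreal C * emeasure lborel {Inf S<..<Sup S}"
      using le[OF eq(2)] eq(2) \<open>0 \<le> C\<close> by (simp add: ennreal_mult)
    then show ?thesis using eq(1) by simp
  qed
  have "emeasure N U = (\<integral>\<^sup>+S. emeasure N S \<partial>count_space D)"
    unfolding U using open_D count fam sets by (intro emeasure_UN_countable) auto
  also have "\<dots> \<le> (\<integral>\<^sup>+S. ennreal C * emeasure lborel S \<partial>count_space D)"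
    using piece by (intro nn_integral_mono) simp
  also have "\<dots> = ennreal C * (\<integral>\<^sup>+S. emeasure lborel S \<partial>count_space D)"
    by (simp add: nn_integral_cmult)
  also have "(\<integral>\<^sup>+S. emeasure lborel S \<partial>count_space D) = emeasure lborel U"
    unfolding U using open_D count fam by (intro emeasure_UN_countable[symmetric]) auto
  finally show ?thesis .
qed

text \<open>Outer regularity of Lebesgue measure encloses the set in open sets of small length.
  Intersecting them with a ball provides the boundedness used to split them into interval
  components.\<close>

lemma null_set_if_intervals_le:
  fixes N :: "real measure" and B :: "real set"
  assumes sets: "sets N = sets borel"
    and le: "\<And>u v. u < v \<Longrightarrow> emeasure N {u<..<v} \<le> ennreal (C * (v - u))" and "0 \<le> C"
    and B: "B \<in> null_sets lborel" "bounded B"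
  shows "emeasure N B = 0"
proof -
  have BB: "B \<in> sets borel" "emeasure lborel B = 0" using B(1) by auto
  obtain V where V: "open V" "B \<subseteq> V" "bounded V"
  proof -
    obtain e where "B \<subseteq> ball 0 e" using \<open>bounded B\<close> bounded_subset_ballD by blast
    then show ?thesis using that[of "ball 0 e"] by simp
  qed
  have "emeasure N B \<le> 0"
  proof (rule ennreal_le_epsilon)
    fix e :: real assume "0 < e"
    define d where "d = e / (C + 1)"
    have "d > 0" using \<open>0 < e\<close> \<open>0 \<le> C\<close> by (simp add: d_def)
    then obtain U where U: "open U" "B \<subseteq> U" "emeasure lborel (U - B) < ennreal d"
      using outer_regular_lborel[OF BB(1)] by blast
    have "emeasure lborel U \<le> emeasure lborel ((U - B) \<union> B)" using U BB by (intro emeasure_mono) auto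
    also have "\<dots> \<le> emeasure lborel (U - B) + emeasure lborel B"
      using U BB by (intro emeasure_subadditive) auto
    also have "\<dots> \<le> ennreal d" using U(3) BB(2) by simp
    finally have Ud: "emeasure lborel U \<le> ennreal d" .
    have "emeasure N B \<le> emeasure N (U \<inter> V)" using U V sets by (intro emeasure_mono) auto
    also have "\<dots> \<le> ennreal C * emeasure lborel (U \<inter> V)"
      using U V by (intro emeasure_open_le_if_intervals_le[OF sets _ _ le \<open>0 \<le> C\<close>]) auto
    also have "\<dots> \<le> ennreal C * emeasure lborel U"
      using U V by (intro mult_left_mono emeasure_mono) auto
    also have "\<dots> \<le> ennreal C * ennreal d" using Ud by (intro mult_left_mono) auto
    also have "\<dots> = ennreal (C * d)" using \<open>0 \<le> C\<close> \<open>d > 0\<close> by (simp add: ennreal_mult)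
    also have "\<dots> \<le> ennreal e"
      using \<open>0 < e\<close> \<open>0 \<le> C\<close> by (intro ennreal_leI) (simp add: d_def field_simps)
    finally show "emeasure N B \<le> 0 + ennreal e" by simp
  qed
  then show ?thesis by simp
qed

text \<open>A single map and a single orbit, with the parameter forgotten; \<open>F\<close> contains
  the discontinuities. Frequencies are prescribed for rational intervals only, so that almost every
  parameter qualifies for all of them at once.\<close>

locale bounded_frequency_orbit =
  fixes f :: "real \<Rightarrow> real" and \<mu> :: "real measure" and x C :: real and F :: "real set"
  assumes f: "f \<in> {0..1} \<rightarrow> {0..1}"
    and F: "finite F" "\<And>z. z \<in> {0..1} - F \<Longrightarrow> isCont f z"
    and unique_acip: "\<And>\<nu>. acip f \<nu> \<longleftrightarrow> \<nu> = \<mu>"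
    and x: "x \<in> {0..1}"
    and C: "0 < C"
    and frequency: "\<And>y r. y \<in> \<rat> \<Longrightarrow> r \<in> \<rat> \<Longrightarrow> 0 < r \<Longrightarrow>
      \<forall>\<^sub>F n in sequentially. real (card {k. k < n \<and> \<bar>(f ^^ k) x - y\<bar> \<le> r}) \<le> C * r * n"
begin

abbreviation orb :: "nat \<Rightarrow> real" where "orb k \<equiv> (f ^^ k) x"

lemma orb_unit: "orb k \<in> {0..1}"
  by (rule funpow_unit_interval[OF f x])

text \<open>The empirical measures regarded on the whole line, where tightness and weak convergence
  are formulated. The index shift makes every member a probability measure.\<close>

definition E :: "nat \<Rightarrow> real measure" where
  "E n = distr (uniform_count_measure {..<Suc n}) borel orb"

lemma orb_measurable [measurable]: "orb \<in> measurable (uniform_count_measure {..<Suc n}) borel"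
  by (auto simp: measurable_def space_uniform_count_measure sets_uniform_count_measure)

lemma E_real_distribution: "real_distribution (E n)"
proof -
  interpret prob_space "uniform_count_measure {..<Suc n}"
    by (rule prob_space_uniform_count_measure) auto
  show ?thesis unfolding E_def by (rule real_distribution_distr) simp
qed

lemma integral_E:
  fixes g :: "real \<Rightarrow> real"
  assumes [measurable]: "g \<in> borel_measurable borel"
  shows "(\<integral>z. g z \<partial>E n) = (\<Sum>k<Suc n. g (orb k)) / Suc n"
  unfolding E_def by (simp add: integral_distr integral_uniform_count_measure)

lemma tight_E: "tight E"
  unfolding tight_def
proof (intro conjI allI impI)
  fix \<epsilon> :: real assume "0 < \<epsilon>"
  have "measure (E n) {-1<..1} = 1" for n
  proof -
    interpret E: real_distribution "E n" by (rule E_real_distribution)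
    have "measure (E n) {-1<..1} = (\<integral>z. indicator {-1<..1} z \<partial>E n)" by simp
    also have "\<dots> = (\<Sum>k<Suc n. indicator {-1<..1} (orb k)) / Suc n" by (rule integral_E) simp
    also have "(\<Sum>k<Suc n. indicator {-1<..1} (orb k)) = (\<Sum>k<Suc n. 1 :: real)"
      using orb_unit by (intro sum.cong) (auto simp: indicator_def dest!: meta_spec intro: less_le_trans[of "-1" 0])
    finally show ?thesis by simp
  qed
  then show "\<exists>a b. a < b \<and> (\<forall>n. 1 - \<epsilon> < measure (E n) {a<..b})"
    using \<open>0 < \<epsilon>\<close> by (intro exI[of _ "-1"] exI[of _ 1]) auto
qed (rule E_real_distribution)

section \<open>Identification of an arbitrary subsequential weak limit\<close>

context
  fixes s :: "nat \<Rightarrow> nat" and N :: "real measure"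
  assumes s: "strict_mono s" and N: "real_distribution N" and conv: "weak_conv_m (E \<circ> s) N"
begin

interpretation N: real_distribution N by (rule N)

lemma limit_integral:
  fixes g :: "real \<Rightarrow> real"
  assumes "emeasure N {z. \<not> isCont g z} = 0" "\<And>z. \<bar>g z\<bar> \<le> B" "g \<in> borel_measurable borel"
  shows "(\<lambda>n. (\<Sum>k<Suc (s n). g (orb k)) / Suc (s n)) \<longlonglongrightarrow> (\<integral>z. g z \<partial>N)"
proof -
  have "(\<lambda>n. \<integral>z. g z \<partial>(E \<circ> s) n) \<longlonglongrightarrow> (\<integral>z. g z \<partial>N)"
    by (rule weak_conv_imp_bdd_ae_continuous_conv[OF _ N conv assms(1) _ assms(3), where B = B])
      (use E_real_distribution assms(2) in simp_all)
  then show ?thesis by (simp add: integral_E[OF assms(3)])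
qed

lemma limit_integral_continuous:
  fixes g :: "real \<Rightarrow> real"
  assumes g: "continuous_on UNIV g" "\<And>z. \<bar>g z\<bar> \<le> B"
  shows "(\<lambda>n. (\<Sum>k<Suc (s n). g (orb k)) / Suc (s n)) \<longlonglongrightarrow> (\<integral>z. g z \<partial>N)"
proof (rule limit_integral[OF _ g(2)])
  have "{z. \<not> isCont g z} = {}" using g(1) by (auto simp: continuous_on_eq_continuous_at)
  then show "emeasure N {z. \<not> isCont g z} = 0" by simp
  show "g \<in> borel_measurable borel" using g(1) by (rule borel_measurable_continuous_onI)
qed

text \<open>The truncated distance to the unit interval is continuous and vanishes along the orbit,
  so its integral against the limit is zero.\<close>

lemma limit_AE_unit: "AE z in N. z \<in> {0..1}"
proof -
  define g :: "real \<Rightarrow> real" where "g z = min 1 (max 0 (max (- z) (z - 1)))" for z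
  have cont: "continuous_on UNIV g" unfolding g_def by (intro continuous_intros)
  have [measurable]: "g \<in> borel_measurable borel" using cont by (rule borel_measurable_continuous_onI)
  have bdd: "\<bar>g z\<bar> \<le> 1" for z by (auto simp: g_def)
  have "g (orb k) = 0" for k using orb_unit[of k] by (auto simp: g_def)
  then have "(\<lambda>n. 0) \<longlonglongrightarrow> (\<integral>z. g z \<partial>N)"
    using limit_integral_continuous[OF cont bdd] by simp
  then have "(\<integral>z. g z \<partial>N) = 0" by (simp add: LIMSEQ_const_iff)
  moreover have "integrable N g" using bdd by (intro N.integrable_const_bound[of _ 1]) auto
  moreover have "AE z in N. 0 \<le> g z" by (auto simp: g_def)
  ultimately have "AE z in N. g z = 0" by (simp add: integral_nonneg_eq_0_iff_AE)
  then show ?thesis by eventually_elim (auto simp: g_def min_def max_def split: if_splits)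
qed

lemma limit_cball_le:
  assumes y: "y \<in> \<rat>" and r: "r \<in> \<rat>" "0 < r"
  shows "measure N {z. \<bar>z - y\<bar> \<le> r} \<le> 2 * C * r"
proof -
  \<comment> \<open>A continuous trapezoid between the indicators of the balls of radius
    \<open>r\<close> and \<open>2 * r\<close>. The larger radius doubles the constant.\<close>
  define g :: "real \<Rightarrow> real" where "g z = max 0 (min 1 (2 - \<bar>z - y\<bar> / r))" for z
  have cont: "continuous_on UNIV g" unfolding g_def using r by (intro continuous_intros) auto
  have [measurable]: "g \<in> borel_measurable borel" using cont by (rule borel_measurable_continuous_onI)
  have bdd: "\<bar>g z\<bar> \<le> 1" for z by (auto simp: g_def)
  have set [measurable]: "{z. \<bar>z - y\<bar> \<le> r} \<in> sets borel" by measurable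
  have "measure N {z. \<bar>z - y\<bar> \<le> r} = (\<integral>z. indicator {z. \<bar>z - y\<bar> \<le> r} z \<partial>N)" by simp
  also have "\<dots> \<le> (\<integral>z. g z \<partial>N)"
  proof (rule integral_mono)
    show "integrable N g" using bdd by (intro N.integrable_const_bound[of _ 1]) auto
    show "indicator {z. \<bar>z - y\<bar> \<le> r} z \<le> g z" for z
      using r by (auto simp: g_def indicator_def field_simps)
    show "integrable N (indicator {z. \<bar>z - y\<bar> \<le> r} :: real \<Rightarrow> real)"
      by (intro N.integrable_const_bound[of _ 1]) (auto simp: indicator_def)
  qed
  also have "\<dots> \<le> 2 * C * r"
  proof (rule tendsto_upperbound[OF limit_integral_continuous[OF cont bdd]])
    have "\<forall>\<^sub>F n in sequentially. real (card {k. k < n \<and> \<bar>orb k - y\<bar> \<le> 2 * r}) \<le> C * (2 * r) * n"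
      using y r by (intro frequency) auto
    then have "\<forall>\<^sub>F n in sequentially.
        real (card {k. k < Suc (s n) \<and> \<bar>orb k - y\<bar> \<le> 2 * r}) \<le> C * (2 * r) * Suc (s n)"
      using filterlim_compose[OF filterlim_Suc filterlim_subseq[OF s]]
      by (rule eventually_compose_filterlim)
    then show "\<forall>\<^sub>F n in sequentially. (\<Sum>k<Suc (s n). g (orb k)) / Suc (s n) \<le> 2 * C * r"
    proof eventually_elim
      case (elim n)
      have "g z \<le> indicator {z. \<bar>z - y\<bar> \<le> 2 * r} z" for z
        using r by (auto simp: g_def indicator_def field_simps)
      then have "(\<Sum>k<Suc (s n). g (orb k)) \<le> (\<Sum>k<Suc (s n). indicator {z. \<bar>z - y\<bar> \<le> 2 * r} (orb k))"
        by (intro sum_mono)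
      also have "\<dots> = real (card {k. k < Suc (s n) \<and> \<bar>orb k - y\<bar> \<le> 2 * r})"
      proof -
        have "(\<Sum>k<Suc (s n). indicator {z. \<bar>z - y\<bar> \<le> 2 * r} (orb k)) =
            (\<Sum>k\<in>{..<Suc (s n)}. if k \<in> {k. \<bar>orb k - y\<bar> \<le> 2 * r} then 1 else (0::real))"
          by (intro sum.cong) (auto simp: indicator_def)
        also have "\<dots> = real (card ({..<Suc (s n)} \<inter> {k. \<bar>orb k - y\<bar> \<le> 2 * r}))"
          by (simp add: sum.If_cases del: sum.lessThan_Suc)
        also have "{..<Suc (s n)} \<inter> {k. \<bar>orb k - y\<bar> \<le> 2 * r} = {k. k < Suc (s n) \<and> \<bar>orb k - y\<bar> \<le> 2 * r}"
          by auto
        finally show ?thesis .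
      qed
      also note elim
      finally show ?case by (simp add: pos_divide_le_eq mult_ac)
    qed
  qed simp
  finally show ?thesis .
qed

lemma limit_interval_le:
  assumes "u < v"
  shows "emeasure N {u<..<v} \<le> ennreal (4 * C * (v - u))"
proof -
  obtain y where y: "y \<in> \<rat>" "u < y" "y < v" using Rats_dense_in_real[OF assms] by blast
  obtain r where r: "r \<in> \<rat>" "v - u < r" "r < 2 * (v - u)"
    using Rats_dense_in_real[of "v - u" "2 * (v - u)"] assms by auto
  have "measure N {u<..<v} \<le> measure N {z. \<bar>z - y\<bar> \<le> r}"
    using y r by (intro N.finite_measure_mono) auto
  also have "\<dots> \<le> 2 * C * r" using y r assms by (intro limit_cball_le) auto
  also have "\<dots> \<le> 4 * C * (v - u)" using r(3) C by simp
  finally show ?thesis by (simp add: N.emeasure_eq_measure ennreal_leI)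
qed

lemma limit_null: "B \<in> null_sets lborel \<Longrightarrow> bounded B \<Longrightarrow> emeasure N B = 0"
  using limit_interval_le C by (intro null_set_if_intervals_le[where C = "4 * C"]) auto

lemma limit_finite_null: "finite B \<Longrightarrow> emeasure N B = 0"
  by (intro limit_null finite_imp_null_set_lborel finite_imp_bounded)

text \<open>The limit lives on the line, so \<open>f\<close> is continued by 0 to a Borel function.
  This creates new discontinuities at 0 and 1 at most, which the limit does not charge.\<close>

definition f_ext :: "real \<Rightarrow> real" where
  "f_ext z = (if z \<in> {0..1} then f z else 0)"

lemma f_measurable_unit: "f \<in> measurable unit_borel unit_borel"
  and sets_\<mu>: "sets \<mu> = sets unit_borel"
proof -
  have "acip f \<mu>" using unique_acip by simp
  then show "sets \<mu> = sets unit_borel" and "f \<in> measurable unit_borel unit_borel"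
    unfolding acip_def by (auto cong: measurable_cong_sets)
qed

lemma f_ext_measurable [measurable]: "f_ext \<in> borel_measurable borel"
proof -
  have "f \<in> borel_measurable unit_borel"
    using f_measurable_unit by (auto simp: measurable_restrict_space2_iff)
  then show ?thesis
    unfolding f_ext_def by (subst (asm) measurable_restrict_space_iff) auto
qed

lemma f_ext_isCont:
  assumes "z \<notin> insert 0 (insert 1 F)"
  shows "isCont f_ext z"
proof (cases "z \<in> {0..1}")
  case True
  then have z: "z \<in> {0<..<1}" "isCont f z" using assms F(2) by auto
  have "\<forall>\<^sub>F w in nhds z. w \<in> {0<..<1}" using z(1) by (intro eventually_nhds_in_open) auto
  then have "\<forall>\<^sub>F w in nhds z. f_ext w = f w" by eventually_elim (auto simp: f_ext_def)
  then show ?thesis using z(2) isCont_cong by blast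
next
  case False
  have "\<forall>\<^sub>F w in nhds z. w \<in> - {0..1}" using False by (intro eventually_nhds_in_open) auto
  then have "\<forall>\<^sub>F w in nhds z. f_ext w = 0" by eventually_elim (auto simp: f_ext_def)
  then have "isCont f_ext z \<longleftrightarrow> isCont (\<lambda>_. 0 :: real) z" by (rule isCont_cong)
  then show ?thesis by simp
qed

lemma f_ext_orb: "f_ext (orb k) = orb (Suc k)"
  using orb_unit[of k] by (simp add: f_ext_def)

text \<open>For bounded continuous \<open>g\<close> the function \<open>g \<circ> f_ext\<close> has
  finitely many discontinuities, a null set of the limit, so weak convergence applies to it too.
  Along the orbit the averages of \<open>g \<circ> f_ext\<close> and of \<open>g\<close> differ only
  by a telescoping boundary term.\<close>

lemma limit_invariant: "distr N borel f_ext = N"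
proof (rule cdf_unique)
  show D: "real_distribution (distr N borel f_ext)"
    by (rule N.real_distribution_distr) simp
  have int_eq: "(\<integral>z. g (f_ext z) \<partial>N) = (\<integral>z. g z \<partial>N)"
    if g: "\<And>z. isCont g z" "\<And>z. \<bar>g z\<bar> \<le> 1" for g :: "real \<Rightarrow> real"
  proof -
    have cont: "continuous_on UNIV g" using g(1) by (simp add: continuous_on_eq_continuous_at)
    have [measurable]: "g \<in> borel_measurable borel" using cont by (rule borel_measurable_continuous_onI)
    have "{z. \<not> isCont (\<lambda>z. g (f_ext z)) z} \<subseteq> insert 0 (insert 1 F)"
      using f_ext_isCont g(1) by (auto intro: isCont_o2)
    then have "finite {z. \<not> isCont (\<lambda>z. g (f_ext z)) z}" using F(1) finite_subset by blast
    then have "(\<lambda>n. (\<Sum>k<Suc (s n). g (f_ext (orb k))) / Suc (s n)) \<longlonglongrightarrow> (\<integral>z. g (f_ext z) \<partial>N)"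
      using g(2) by (intro limit_integral limit_finite_null) auto
    moreover have "(\<lambda>n. (\<Sum>k<Suc (s n). g (orb k)) / Suc (s n)) \<longlonglongrightarrow> (\<integral>z. g z \<partial>N)"
      using cont g(2) by (rule limit_integral_continuous)
    ultimately have lim: "(\<lambda>n. (\<Sum>k<Suc (s n). g (f_ext (orb k))) / Suc (s n) -
        (\<Sum>k<Suc (s n). g (orb k)) / Suc (s n)) \<longlonglongrightarrow> (\<integral>z. g (f_ext z) \<partial>N) - (\<integral>z. g z \<partial>N)"
      by (rule tendsto_diff)
    have "(\<lambda>n. (\<Sum>k<Suc (s n). g (f_ext (orb k))) / Suc (s n) -
        (\<Sum>k<Suc (s n). g (orb k)) / Suc (s n)) \<longlonglongrightarrow> 0"
    proof (rule Lim_null_comparison)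
      have tele: "(\<Sum>k<m. g (f_ext (orb k))) - (\<Sum>k<m. g (orb k)) = g (orb m) - g (orb 0)" for m
        unfolding f_ext_orb sum_subtractf[symmetric] by (rule sum_lessThan_telescope)
      have le2: "\<bar>g (orb m) - g (orb 0)\<bar> \<le> 2" for m
        using g(2)[of "orb m"] g(2)[of "orb 0"] by linarith
      show "\<forall>\<^sub>F n in sequentially. norm ((\<Sum>k<Suc (s n). g (f_ext (orb k))) / Suc (s n) -
          (\<Sum>k<Suc (s n). g (orb k)) / Suc (s n)) \<le> 2 / Suc (s n)"
        unfolding diff_divide_distrib[symmetric] tele
        by (intro always_eventually allI) (simp only: real_norm_def abs_divide abs_of_nat, intro divide_right_mono le2, simp)
      have "filterlim (\<lambda>n. real (Suc (s n))) at_top sequentially"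
        using filterlim_compose[OF filterlim_Suc filterlim_subseq[OF s]]
        by (rule filterlim_compose[OF filterlim_real_sequentially])
      then show "(\<lambda>n. 2 / real (Suc (s n))) \<longlonglongrightarrow> 0" by (rule tendsto_divide_0[OF tendsto_const filterlim_at_top_imp_at_infinity])
    qed
    with lim have "(\<integral>z. g (f_ext z) \<partial>N) - (\<integral>z. g z \<partial>N) = 0" by (rule LIMSEQ_unique)
    then show ?thesis by simp
  qed
  \<comment> \<open>A constant sequence converging weakly to \<open>N\<close> has its distribution
    function wherever that of \<open>N\<close> is continuous, and this is everywhere because
    \<open>N\<close> has no atoms.\<close>
  have "weak_conv_m (\<lambda>_. distr N borel f_ext) N"
  proof (rule integral_bdd_continuous_conv_imp_weak_conv)
    fix g :: "real \<Rightarrow> real" assume g: "\<And>z. isCont g z" "\<And>z. \<bar>g z\<bar> \<le> 1"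
    have [measurable]: "g \<in> borel_measurable borel"
      using g(1) by (intro borel_measurable_continuous_onI) (simp add: continuous_on_eq_continuous_at)
    show "(\<lambda>n. integral\<^sup>L (distr N borel f_ext) g) \<longlonglongrightarrow> integral\<^sup>L N g"
      using int_eq[OF g] by (simp add: integral_distr)
  qed (use D N in auto)
  moreover have "isCont (cdf N) z" for z
    using limit_finite_null[of "{z}"] by (simp add: N.isCont_cdf N.emeasure_eq_measure)
  ultimately have "(\<lambda>n::nat. cdf (distr N borel f_ext) z) \<longlonglongrightarrow> cdf N z" for z
    by (simp add: weak_conv_m_def weak_conv_def)
  then show "cdf (distr N borel f_ext) = cdf N"
    by (intro ext) (simp add: LIMSEQ_const_iff)
qed (rule N)

text \<open>The limit is carried by the unit interval, invariant, and absolutely continuous because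
  it inherits the interval bound; uniqueness identifies it.\<close>

lemma limit_restrict: "restrict_space N {0..1} = \<mu>"
proof -
  define N' where "N' = restrict_space N {0..1}"
  have sets_N': "sets N' = sets unit_borel" unfolding N'_def by (rule sets_restrict_space_cong) simp
  have space_N': "space N' = {0..1}" by (simp add: N'_def space_restrict_space)
  have em: "emeasure N' A = emeasure N A" if "A \<subseteq> {0..1}" for A
    using that by (simp add: N'_def emeasure_restrict_space)
  have f_meas [measurable]: "f \<in> measurable N' N'"
    using f_measurable_unit measurable_cong_sets[OF sets_N' sets_N'] by simp
  have "acip f N'"
    unfolding acip_def
  proof (intro conjI)
    have "emeasure N {0..1} = 1" using limit_AE_unit by (simp add: N.emeasure_eq_1_AE)
    then show "prob_space N'" unfolding N'_def by (intro prob_space_restrict_space) auto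
    show "absolutely_continuous (restrict_space lborel {0..1}) N'"
      unfolding absolutely_continuous_def
    proof
      have unit: "{0..1 :: real} \<in> sets lborel" by simp
      fix A assume "A \<in> null_sets (restrict_space lborel {0..1 :: real})"
      then have A: "A \<subseteq> {0..1}" "A \<in> null_sets lborel"
        unfolding null_sets_restrict_space[OF unit] by auto
      then have "emeasure N A = 0"
        by (intro limit_null) (auto intro: bounded_subset[OF bounded_closed_interval])
      then have "A \<in> null_sets N" using null_setsD2[OF A(2)] by (intro null_setsI) auto
      then show "A \<in> null_sets N'" using A(1) by (simp add: N'_def null_sets_restrict_space)
    qed
    show "distr N' N' f = N'"
    proof (rule measure_eqI)
      fix A assume "A \<in> sets (distr N' N' f)"
      then have A: "A \<in> sets N'" by simp
      then have A': "A \<in> sets borel" "A \<subseteq> {0..1}" by (auto simp: N'_def sets_restrict_space_iff)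
      have pre: "f -` A \<inter> {0..1} \<in> sets borel"
        using measurable_sets[OF f_meas A] by (simp add: space_N' N'_def sets_restrict_space_iff)
      have "emeasure (distr N' N' f) A = emeasure N' (f -` A \<inter> space N')"
        using A by (simp add: emeasure_distr)
      also have "\<dots> = emeasure N (f -` A \<inter> {0..1})" unfolding space_N' by (rule em) simp
      also have "\<dots> = emeasure N (f_ext -` A)"
      proof (rule emeasure_eq_AE)
        show "AE z in N. z \<in> f -` A \<inter> {0..1} \<longleftrightarrow> z \<in> f_ext -` A"
          using limit_AE_unit by eventually_elim (simp add: f_ext_def)
      qed (use pre measurable_sets[OF f_ext_measurable A'(1)] in simp_all)
      also have "\<dots> = emeasure (distr N borel f_ext) A" using A' by (simp add: emeasure_distr)
      also have "\<dots> = emeasure N' A" unfolding limit_invariant using A' by (simp add: em)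
      finally show "emeasure (distr N' N' f) A = emeasure N' A" .
    qed simp
  qed (use sets_N' f_meas in auto)
  then show ?thesis using unique_acip by (simp add: N'_def)
qed

lemma limit_eq: "N = distr \<mu> borel (\<lambda>z. z)"
proof (rule measure_eqI)
  fix A assume "A \<in> sets N"
  then have A: "A \<in> sets borel" by simp
  have meas: "(\<lambda>z. z) \<in> measurable (restrict_space N {0..1}) borel"
    by (rule measurable_restrict_space1) simp
  have "AE z in N. z \<in> A \<longleftrightarrow> z \<in> A \<inter> {0..1}" using limit_AE_unit by eventually_elim auto
  then have "emeasure N A = emeasure N (A \<inter> {0..1})" using A by (intro emeasure_eq_AE) auto
  also have "\<dots> = emeasure (restrict_space N {0..1}) (A \<inter> {0..1})"
    by (simp add: emeasure_restrict_space)
  also have "\<dots> = emeasure (distr (restrict_space N {0..1}) borel (\<lambda>z. z)) A"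
    using A meas by (simp add: emeasure_distr space_restrict_space)
  finally show "emeasure N A = emeasure (distr \<mu> borel (\<lambda>z. z)) A" by (simp add: limit_restrict)
qed simp

end

text \<open>The sequence is tight and all its subsequential limits coincide, so it converges weakly
  as a whole; the index shift is undone at the end.\<close>

theorem typical: "typical f \<mu> x"
  unfolding typical_def weak_star_conv_def
proof (intro allI impI)
  fix \<phi> :: "real \<Rightarrow> real" assume \<phi>: "continuous_on {0..1} \<phi>"
  have acip: "acip f \<mu>" using unique_acip by simp
  then interpret \<mu>: prob_space \<mu> by (simp add: acip_def)
  have sets_\<mu>: "sets \<mu> = sets unit_borel" using acip by (simp add: acip_def)
  have id_meas [measurable]: "(\<lambda>z. z) \<in> measurable \<mu> borel"
    by (subst measurable_cong_sets[OF sets_\<mu> refl]) (rule measurable_restrict_space1, simp)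
  define M where "M = distr \<mu> borel (\<lambda>z. z)"
  have M: "real_distribution M" unfolding M_def by (rule \<mu>.real_distribution_distr) simp
  have weak: "weak_conv_m E M"
    using E_real_distribution M tight_E
  proof (rule tight_subseq_weak_converge)
    fix s \<nu> assume "strict_mono (s :: nat \<Rightarrow> nat)" "real_distribution \<nu>" "weak_conv_m (E \<circ> s) \<nu>"
    then show "weak_conv_m (E \<circ> s) M" using limit_eq unfolding M_def by metis
  qed
  \<comment> \<open>Clamping the argument extends the test function to a bounded continuous function
    on the line without changing it on the unit interval.\<close>
  define g where "g z = \<phi> (max 0 (min 1 z))" for z
  have cont: "continuous_on UNIV g"
    unfolding g_def by (intro continuous_on_compose2[OF \<phi>] continuous_intros) auto
  obtain B where B: "\<And>z. z \<in> {0..1} \<Longrightarrow> \<bar>\<phi> z\<bar> \<le> B"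
    using compact_imp_bounded[OF compact_continuous_image[OF \<phi> compact_Icc]] unfolding bounded_iff
    by (metis imageI real_norm_def)
  have [measurable]: "g \<in> borel_measurable borel" using cont by (rule borel_measurable_continuous_onI)
  have g_eq: "g z = \<phi> z" if "z \<in> {0..1}" for z using that by (auto simp: g_def)
  have "(\<lambda>n. integral\<^sup>L (E n) g) \<longlonglongrightarrow> integral\<^sup>L M g"
    using E_real_distribution M weak
  proof (rule weak_conv_imp_integral_bdd_continuous_conv)
    show "isCont g z" for z using cont by (simp add: continuous_on_eq_continuous_at)
    show "norm (g z) \<le> B" for z using B[of "max 0 (min 1 z)"] by (simp add: g_def)
  qed
  moreover have "integral\<^sup>L (E n) g = (\<integral>z. \<phi> z \<partial>empirical_measure f x (Suc n))" for n
    using orb_unit by (simp add: integral_E integral_empirical_measure[OF f x \<phi>] g_eq del: sum.lessThan_Suc)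
  moreover have "integral\<^sup>L M g = (\<integral>z. \<phi> z \<partial>\<mu>)"
  proof -
    have "space \<mu> = {0..1}" using sets_eq_imp_space_eq[OF sets_\<mu>] by (simp add: space_restrict_space)
    then have "(\<integral>z. g z \<partial>\<mu>) = (\<integral>z. \<phi> z \<partial>\<mu>)"
      using g_eq by (intro Bochner_Integration.integral_cong) auto
    then show ?thesis unfolding M_def by (simp add: integral_distr)
  qed
  ultimately have "(\<lambda>n. \<integral>z. \<phi> z \<partial>empirical_measure f x (Suc n)) \<longlonglongrightarrow> (\<integral>z. \<phi> z \<partial>\<mu>)" by simp
  then show "(\<lambda>n. \<integral>z. \<phi> z \<partial>empirical_measure f x n) \<longlonglongrightarrow> (\<integral>z. \<phi> z \<partial>\<mu>)"
    by (rule LIMSEQ_imp_Suc)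
qed

end

section \<open>Typicality\<close>

context markov_family
begin

lemma typical_if_frequencies_bounded:
  assumes a: "a \<in> I"
    and freq: "\<And>y r. y \<in> \<rat> \<Longrightarrow> r \<in> \<rat> \<Longrightarrow> 0 < r \<Longrightarrow>
      \<forall>\<^sub>F n in sequentially. real (card {k. k < n \<and> \<bar>x k a - y\<bar> \<le> r}) \<le> 16 * density_const * r * n"
  shows "typical (T a) (\<mu> a) (X a)"
proof -
  interpret bounded_frequency_orbit "T a" "\<mu> a" "X a" "16 * density_const" "Pt a"
  proof
    show "T a \<in> {0..1} \<rightarrow> {0..1}" using self_map[OF a] .
    show "finite (Pt a)" by (simp add: partition_points_def)
    show "isCont (T a) z" if "z \<in> {0..1} - Pt a" for z
    proof -
      obtain k where "k \<in> {1..p0}" "z \<in> Br a k" by (rule branch_exists[OF a \<open>z \<in> {0..1} - Pt a\<close>])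
      then show ?thesis using T_differentiable[OF a] field_differentiable_imp_continuous_at by blast
    qed
    show "acip (T a) \<nu> \<longleftrightarrow> \<nu> = \<mu> a" for \<nu> by (rule unique_acip[OF a])
    show "X a \<in> {0..1}" using X_unit a by blast
    show "0 < 16 * density_const" using density_const_pos by simp
  qed (use freq in \<open>simp add: orbit_map_def\<close>)
  show ?thesis by (rule typical)
qed

text \<open>Countably many rational pairs \<open>y\<close>, \<open>r\<close> allow one null set to
  serve all of them.\<close>

lemma AE_typical_inner_P:
  assumes "\<omega> \<in> inner_P j" "j_min \<le> j"
  shows "AE a in lborel. a \<in> \<omega> \<longrightarrow> typical (T a) (\<mu> a) (X a)"
proof -
  have \<omega>: "\<omega> \<in> P j" using assms(1) by (simp add: inner_P_def)
  have "AE a in restrict_space lborel \<omega>. \<forall>y\<in>\<rat>. \<forall>r\<in>\<rat> \<inter> {0<..}. \<forall>\<^sub>F n in sequentially.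
      real (card {k. k < n \<and> \<bar>x k a - y\<bar> \<le> r}) \<le> 16 * density_const * r * n"
    using AE_visit_frequency[OF assms]
    by (simp add: AE_ball_countable countable_rat countable_Int1)
  then have "AE a in lborel. a \<in> \<omega> \<longrightarrow> (\<forall>y\<in>\<rat>. \<forall>r\<in>\<rat> \<inter> {0<..}. \<forall>\<^sub>F n in sequentially.
      real (card {k. k < n \<and> \<bar>x k a - y\<bar> \<le> r}) \<le> 16 * density_const * r * n)"
    using P_memD(2)[OF \<omega>] by (subst (asm) AE_restrict_space_iff) auto
  then show ?thesis
  proof eventually_elim
    case (elim a)
    show ?case
    proof
      assume "a \<in> \<omega>"
      then show "typical (T a) (\<mu> a) (X a)"
        using elim P_memD(6)[OF \<omega>] by (intro typical_if_frequencies_bounded) auto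
    qed
  qed
qed

text \<open>Off a countable set of parameters every level contains \<open>a\<close>, in particular
  \<open>a\<close> is interior to \<open>I\<close>, and then some inner interval of high level
  contains \<open>a\<close>. There are countably many such intervals in all.\<close>

lemma AE_typical: "AE a in lborel. a \<in> I \<longrightarrow> typical (T a) (\<mu> a) (X a)"
proof -
  have "AE a in lborel. \<forall>j. \<forall>\<omega>\<in>inner_P j. j_min \<le> j \<longrightarrow> a \<in> \<omega> \<longrightarrow> typical (T a) (\<mu> a) (X a)"
  proof (subst AE_all_countable, intro allI)
    fix j
    have "countable (inner_P j)"
      using countable_P[of j] by (rule countable_subset[rotated]) (auto simp: inner_P_def)
    then show "AE a in lborel. \<forall>\<omega>\<in>inner_P j. j_min \<le> j \<longrightarrow> a \<in> \<omega> \<longrightarrow> typical (T a) (\<mu> a) (X a)"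
      using AE_typical_inner_P[of _ j]
      by (cases "j_min \<le> j") (simp_all only: AE_ball_countable, simp_all)
  qed
  moreover have "AE a in lborel. \<forall>j. a \<notin> I - \<Union>(P (Suc j))"
  proof (subst AE_all_countable, intro allI)
    fix j
    have "finite (I - \<Union>(P (Suc j)))" by (rule finite_exceptions) simp
    then show "AE a in lborel. a \<notin> I - \<Union>(P (Suc j))"
      by (intro AE_not_in finite_imp_null_set_lborel)
  qed
  ultimately show ?thesis
  proof eventually_elim
    case (elim a)
    show ?case
    proof
      assume "a \<in> I"
      then have cover: "a \<in> \<Union>(P j)" if "1 \<le> j" for j
        using elim(2)[rule_format, of "j - 1"] that by simp
      then obtain \<omega> where "\<omega> \<in> P 1" "a \<in> \<omega>" by blast
      then have "a \<in> interior I" using P_memD(5) by blast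
      then obtain j \<omega> where "j_min \<le> j" "\<omega> \<in> inner_P j" "a \<in> \<omega>"
        using cover by (rule inner_P_exists)
      then show "typical (T a) (\<mu> a) (X a)" using elim(1) by blast
    qed
  qed
qed

end

theorem theorem8p1:
  fixes I :: "real set" and L lam Lam :: real
    and T :: "real \<Rightarrow> real \<Rightarrow> real"
    and p :: "real \<Rightarrow> nat" and b :: "real \<Rightarrow> nat \<Rightarrow> real" and p0 :: nat
    and \<mu> :: "real \<Rightarrow> real measure"
    and X :: "real \<Rightarrow> real"
  assumes "piecewise_expanding_family I L lam Lam T p b \<mu>"
    and "property_i I L p b p0"
    and "property_ii I L T b p0"
    and "property_iii I p b \<mu>"
    and "markov_property I T b p0"
    and "X \<in> I \<rightarrow> {0..1}" and "C1_on I X"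
    and "condition_I I T p b \<mu> X"
  shows "AE a in lborel. a \<in> I \<longrightarrow> typical (T a) (\<mu> a) (X a)"
proof -
  obtain \<delta>0 where \<delta>0: "0 < \<delta>0" "\<forall>k\<in>{1..p0}. \<forall>a\<in>I. \<delta>0 \<le> b a k - b a (k - 1)"
    using assms(2) unfolding property_i_def by blast
  obtain C0 where C0: "1 \<le> C0" "\<forall>j\<ge>1. \<forall>\<omega>\<in>parameter_partition I T p b \<mu> X j. \<forall>a\<in>\<omega>.
        inverse C0 \<le> \<bar>deriv (orbit_map T X j) a / deriv (T a ^^ j) (X a)\<bar> \<and>
        \<bar>deriv (orbit_map T X j) a / deriv (T a ^^ j) (X a)\<bar> \<le> C0"
    using assms(8) unfolding condition_I_def by blast
  interpret piecewise_expanding_family I L lam Lam T p b \<mu> by fact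
  interpret markov_family I L lam Lam T p b \<mu> p0 X C0 \<delta>0
    by unfold_locales (use assms \<delta>0 C0 in \<open>auto simp: property_i_def condition_I_def\<close>)
  show ?thesis by (rule AE_typical)
qed

end
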